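(* Let $(\mathbf u_{\varepsilon,0})_{\varepsilon\in(0,1]}$ be well-prepared initial data and, for each $\varepsilon\in(0,1]$, let $\mathbf u_\varepsilon=(u_{\varepsilon,1},\dots,u_{\varepsilon,n})$ be a solution to the Allen--Cahn system with parameter $\varepsilon$ and initial condition $\mathbf u_{\varepsilon,0}$. There exist $\varepsilon_1>0$ and $C>0$ such that for any $\varepsilon\in(0,\varepsilon_1)$ and any $i\in\{1,\dots,n\}$ we have $$\frac\varepsilon2|\nabla u_{\varepsilon,i}|^2-\frac1\varepsilon W(u_{\varepsilon,i})\le C\varepsilon^{-\frac{1+\alpha}2}\qquad\text{on }\mathbb T^d\times[0,\infty).$$
   Context: Fix positive integers $d,n$ and $\alpha\in(0,1)$. $\mathbb T^d$ is the flat torus ($[0,1)^d$ with periodic boundary conditions). Let $W(u)=u^2(1-u)^2$, $\phi(u)=\int_0^u\sqrt{2W(s)}\,ds$ for $u\in\mathbb R$, $\sigma=\phi(1)$, and for $\varepsilon\in(0,1]$, $\mathbf u\in\mathbb R^n$, $$F_\varepsilon(\mathbf u)=\frac1\varepsilon\sum_{i=1}^nW(u_i)+\frac1{2\varepsilon^\alpha}\Big(\sigma-\sum_{i=1}^n\phi(u_i)\Big)^2,\qquad E_\varepsilon(\mathbf u)=\int_{\mathbb T^d}\Big(\frac\varepsilon2|\nabla\mathbf u|^2+F_\varepsilon(\mathbf u)\Big)dx,$$ where $|\nabla \mathbf u|$ is the Frobenius norm of the Jacobian. Allen--Cahn system with parameter $\varepsilon$ and initial datum $\mathbf u_0$: for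 $1\le i\le n$, $$\varepsilon\partial_tu_i=\varepsilon\Delta u_i-\frac1\varepsilon W'(u_i)+\frac1{\varepsilon^\alpha}\sqrt{2W(u_i)}\Big(\sigma-\sum_{j=1}^n\phi(u_j)\Big)\ \text{in }\mathbb T^d\times(0,\infty),\qquad u_i(\cdot,0)=u_{0,i}.$$ Well-prepared initial data: a family $(\mathbf u_{\varepsilon,0})_{\varepsilon\in(0,1]}$, $\mathbf u_{\varepsilon,0}=(u_{0,\varepsilon,1},\dots,u_{0,\varepsilon,n})\colon\mathbb T^d\to\mathbb R^n$, such that (i) $0\le u_{0,\varepsilon,i}\le1$ in $\mathbb T^d$ for all $i$; (ii) $E_0:=\sup_{\varepsilon\in(0,1]}E_\varepsilon(\mathbf u_{\varepsilon,0})<\infty$; (iii) $\sup_{\varepsilon\in(0,1]}\sup_{\mathbb T^d}\varepsilon|\nabla\mathbf u_{\varepsilon,0}|<\infty$; (iv) there is $C<\infty$ such that for all $i$ and all $\varepsilon\in(0,1]$, $\frac\varepsilon2|\nabla u_{0,\varepsilon,i}|^2-\frac1\varepsilon W(u_{0,\varepsilon,i})\le C\varepsilon^{-\frac{1+\alpha}2}$ in $\mathbb T^d$; (v) $D_0:=\sup_{\varepsilon\in(0,1]}\sup_{x\in\mathbb T^d,\,r\in(0,1]}\frac{\omega_0^\varepsilon(B_r(x))}{\varpi_{d-1}r^{d-1}}<\infty$, where $\omega_0^\varepsilon=(\frac\varepsilon2|\nabla\mathbf u_{\varepsilon,0}|^2+F_\varepsilon(\mathbf u_{\varepsilon,0}))\,dx$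 and $\varpi_{d-1}$ is the volume of the unit ball of $\mathbb R^{d-1}$. *)

theory Defs
  imports "HOL-Analysis.Analysis"
begin

text \<open>
  The torus is \<open>\<real>\<^sup>d / \<int>\<^sup>d\<close> with \<open>d = CARD('d)\<close>: functions on it are \<open>\<int>\<^sup>d\<close>-periodic functions on
  \<^typ>\<open>real ^ 'd\<close>, and integrals over it are integrals over \<open>[0,1)\<^sup>d\<close>.
\<close>

definition torus_periodic :: "(real ^ 'd \<Rightarrow> 'b) \<Rightarrow> bool" where
  "torus_periodic f \<longleftrightarrow> (\<forall>x j. f (x + axis j 1) = f x)"

definition unit_cell :: "(real ^ 'd) set" where
  "unit_cell = {x. \<forall>j. 0 \<le> x $ j \<and> x $ j < 1}"

definition torus_dist :: "real ^ 'd \<Rightarrow> real ^ 'd \<Rightarrow> real" where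
  "torus_dist x y = (INF k\<in>{k. \<forall>j. k $ j \<in> \<int>}. dist x (y + k))"

text \<open>Radii up to 1 occur below, so this is in general not the image of a Euclidean ball that
  embeds into the torus.\<close>

definition torus_ball :: "real ^ 'd \<Rightarrow> real \<Rightarrow> (real ^ 'd) set" where
  "torus_ball x r = {y \<in> unit_cell. torus_dist x y < r}"

definition grad :: "(real ^ 'd \<Rightarrow> real) \<Rightarrow> real ^ 'd \<Rightarrow> real ^ 'd" where
  "grad f x = (\<chi> j. frechet_derivative f (at x) (axis j 1))"

definition laplacian :: "(real ^ 'd \<Rightarrow> real) \<Rightarrow> real ^ 'd \<Rightarrow> real" where
  "laplacian f x = trace (jacobian (grad f) (at x))"

definition W :: "real \<Rightarrow> real" where
  "W u = u\<^sup>2 * (1 - u)\<^sup>2"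

definition phi :: "real \<Rightarrow> real" where
  "phi u = (LBINT s=ereal 0..ereal u. sqrt (2 * W s))"

definition sigma :: real where
  "sigma = phi 1"

definition F :: "real \<Rightarrow> real \<Rightarrow> real ^ 'n \<Rightarrow> real" where
  "F \<alpha> \<epsilon> v = 1 / \<epsilon> * (\<Sum>i\<in>UNIV. W (v $ i))
     + 1 / (2 * \<epsilon> powr \<alpha>) * (sigma - (\<Sum>i\<in>UNIV. phi (v $ i)))\<^sup>2"

text \<open>The norm of \<^typ>\<open>real ^ 'd ^ 'n\<close> is the Frobenius norm.\<close>

definition energy_density :: "real \<Rightarrow> real \<Rightarrow> (real ^ 'd \<Rightarrow> real ^ 'n) \<Rightarrow> real ^ 'd \<Rightarrow> real" where
  "energy_density \<alpha> \<epsilon> v x = \<epsilon> / 2 * (norm (jacobian v (at x)))\<^sup>2 + F \<alpha> \<epsilon> (v x)"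

text \<open>The energy density is nonnegative for positive \<open>\<epsilon>\<close>; with values in \<^typ>\<open>ennreal\<close>,
  finiteness of the energy is not confused with the default value of a non-convergent integral.\<close>

definition energy :: "real \<Rightarrow> real \<Rightarrow> (real ^ 'd \<Rightarrow> real ^ 'n) \<Rightarrow> ennreal" where
  "energy \<alpha> \<epsilon> v = (\<integral>\<^sup>+x\<in>unit_cell. ennreal (energy_density \<alpha> \<epsilon> v x) \<partial>lborel)"

definition energy_measure :: "real \<Rightarrow> real \<Rightarrow> (real ^ 'd \<Rightarrow> real ^ 'n) \<Rightarrow> (real ^ 'd) measure" where
  "energy_measure \<alpha> \<epsilon> v =
     density (restrict_space lborel unit_cell) (\<lambda>x. ennreal (energy_density \<alpha> \<epsilon> v x))"

text \<open>Differentiability everywhere is the least regularity that gives the pointwise bounds on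
  gradients a meaning.\<close>

definition well_prepared :: "real \<Rightarrow> (real \<Rightarrow> real ^ 'd \<Rightarrow> real ^ 'n) \<Rightarrow> bool" where
  "well_prepared \<alpha> u0 \<longleftrightarrow>
     (\<forall>\<epsilon>\<in>{0<..1}. torus_periodic (u0 \<epsilon>) \<and> (\<forall>x. u0 \<epsilon> differentiable (at x))) \<and>
     (\<forall>\<epsilon>\<in>{0<..1}. \<forall>i x. 0 \<le> u0 \<epsilon> x $ i \<and> u0 \<epsilon> x $ i \<le> 1) \<and>
     (SUP \<epsilon>\<in>{0<..1}. energy \<alpha> \<epsilon> (u0 \<epsilon>)) < \<infinity> \<and>
     bdd_above ((\<lambda>(\<epsilon>, x). \<epsilon> * norm (jacobian (u0 \<epsilon>) (at x))) ` ({0<..1} \<times> UNIV)) \<and>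
     (\<exists>C. \<forall>i. \<forall>\<epsilon>\<in>{0<..1}. \<forall>x.
        \<epsilon> / 2 * (norm (grad (\<lambda>y. u0 \<epsilon> y $ i) x))\<^sup>2 - 1 / \<epsilon> * W (u0 \<epsilon> x $ i)
          \<le> C * \<epsilon> powr (- ((1 + \<alpha>) / 2))) \<and>
     (SUP \<epsilon>\<in>{0<..1}. SUP x. SUP r\<in>{0<..1}.
        emeasure (energy_measure \<alpha> \<epsilon> (u0 \<epsilon>)) (torus_ball x r)
          / ennreal (unit_ball_vol (real (CARD('d) - 1)) * r ^ (CARD('d) - 1))) < \<infinity>"

text \<open>The class \<open>C\<^sup>2\<^sup>,\<^sup>1\<close> on positive times: one time derivative and two space derivatives, all
  jointly continuous.\<close>

definition C21 :: "(real \<Rightarrow> real ^ 'd \<Rightarrow> real) \<Rightarrow> bool" where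
  "C21 v \<longleftrightarrow>
     (\<forall>t>0. \<forall>x. (\<lambda>s. v s x) differentiable (at t) \<and> v t differentiable (at x)
        \<and> grad (v t) differentiable (at x)) \<and>
     continuous_on ({0<..} \<times> UNIV) (\<lambda>(t, x). deriv (\<lambda>s. v s x) t) \<and>
     continuous_on ({0<..} \<times> UNIV) (\<lambda>(t, x). grad (v t) x) \<and>
     continuous_on ({0<..} \<times> UNIV) (\<lambda>(t, x). jacobian (grad (v t)) (at x))"

text \<open>Classical solutions, continuous up to the initial time.\<close>

definition allen_cahn_solution ::
  "real \<Rightarrow> real \<Rightarrow> (real ^ 'd \<Rightarrow> real ^ 'n) \<Rightarrow> (real \<Rightarrow> real ^ 'd \<Rightarrow> real ^ 'n) \<Rightarrow> bool" where
  "allen_cahn_solution \<alpha> \<epsilon> u0 u \<longleftrightarrow>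
     (\<forall>t\<ge>0. torus_periodic (u t)) \<and>
     continuous_on ({0..} \<times> UNIV) (\<lambda>(t, x). u t x) \<and>
     (\<forall>i. C21 (\<lambda>t x. u t x $ i)) \<and>
     (\<forall>i. \<forall>t>0. \<forall>x.
        \<epsilon> * deriv (\<lambda>s. u s x $ i) t =
          \<epsilon> * laplacian (\<lambda>y. u t y $ i) x - 1 / \<epsilon> * deriv W (u t x $ i)
          + 1 / \<epsilon> powr \<alpha> * sqrt (2 * W (u t x $ i)) * (sigma - (\<Sum>j\<in>UNIV. phi (u t x $ j)))) \<and>
     (\<forall>x. u 0 x = u0 x)"

end

theory Submission
  imports Defs
begin

text \<open>
  The bound follows from a two-point maximum principle. Put \<open>\<delta> = \<epsilon> powr (1 - \<alpha>)\<close> and let \<open>\<eta>\<close> be a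
  large multiple of \<open>sqrt \<delta>\<close>. Add to the potential the barrier \<open>G v = \<eta> (1 + v (1 - v))\<close>, and let \<open>P\<close>
  be a primitive of \<open>1 / S\<close> with \<open>S = sqrt (2 (W + G))\<close>. The inequality
  \<open>\<epsilon>\<^sup>2 |grad u\<^sub>i|\<^sup>2 / 2 \<le> W u\<^sub>i + G u\<^sub>i\<close> says that \<open>p\<^sub>i = P (u\<^sub>i)\<close> satisfies \<open>|grad p\<^sub>i| \<le> 1/\<epsilon>\<close>, that is,
  that \<open>p\<^sub>i\<close> is Lipschitz in space with constant \<open>1/\<epsilon>\<close>. Since \<open>G \<le> 2 \<eta>\<close>, it implies the claim, and
  initially it holds by the assumption on the discrepancy of the data.

  To see that the Lipschitz bound is preserved, suppose that \<open>p\<^sub>i(t,x) - p\<^sub>i(t,y) - |x - y|/\<epsilon>\<close> has a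
  positive maximum over all \<open>i\<close>, \<open>x\<close>, \<open>y\<close> and all times up to some \<open>T\<close>. There \<open>|grad p\<^sub>i| = 1/\<epsilon>\<close> at both
  points, so the gradient terms in the equation of \<open>p\<^sub>i\<close> absorb the force of the potential. Moving \<open>x\<close> and
  \<open>y\<close> in parallel does not change \<open>|x - y|\<close>, so the Laplacians of \<open>p\<^sub>i\<close> at the two points are ordered.
  What remains are the drift \<open>G'/S\<close> of the barrier and the coupling term of strength \<open>\<delta>\<close>. As \<open>G\<close> is
  concave, the drift at \<open>x\<close> is smaller than the one at \<open>y\<close> by at least \<open>2 \<eta> (p\<^sub>i(t,x) - p\<^sub>i(t,y))\<close>
  (\<open>barrier_drift_decreases\<close>). The coupling term is Lipschitz in the \<open>p\<^sub>j\<close>, whose differences are all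
  bounded by that of \<open>p\<^sub>i\<close>, so it changes by only \<open>O(\<delta>)\<close> times the same quantity
  (\<open>reaction_strictly_decreases\<close>). As \<open>\<eta>\<close> dominates \<open>\<delta>\<close>, this is a contradiction
  (\<open>straightened_solution_lipschitz\<close>).

  The classical alternative, the maximum principle for \<open>|grad u\<^sub>i|\<^sup>2\<close>, differentiates the equation once
  more and starts from the gradient at time \<open>0\<close>. Comparing two points gets by with the regularity of a
  classical solution: two space derivatives at positive times, and mere continuity of \<open>u\<close> at
  time \<open>0\<close>. A preliminary minimum
  principle (\<open>allen_cahn_range\<close>) keeps the components in \<open>[0,1]\<close>, where the inequalities for \<open>W\<close>, \<open>G\<close>
  and \<open>phi\<close> hold.
\<close>

section \<open>Calculus in one variable\<close>

lemma has_real_derivative_integral_from_0: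
  fixes f :: "real \<Rightarrow> real"
  assumes "continuous_on UNIV f"
  shows "((\<lambda>u. LBINT s=ereal 0..ereal u. f s) has_real_derivative f x) (at x)"
proof -
  define r where "r = \<bar>x\<bar> + 1"
  have "((\<lambda>u. LBINT s=ereal 0..ereal u. f s) has_vector_derivative f x) (at x within {-r..r})"
    by (rule interval_integral_FTC2)
      (use continuous_on_subset[OF assms] in \<open>auto simp: r_def\<close>)
  then have "((\<lambda>u. LBINT s=ereal 0..ereal u. f s) has_vector_derivative f x) (at x)"
    by (subst (asm) at_within_interior) (auto simp: r_def)
  then show ?thesis
    by (simp add: has_real_derivative_iff_has_vector_derivative)
qed

lemma difference_le_of_derivative_le:
  fixes f g f' g' :: "real \<Rightarrow> real"
  assumes "b \<le> a"
    and f: "\<And>v. b \<le> v \<Longrightarrow> v \<le> a \<Longrightarrow> (f has_real_derivative f' v) (at v)"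
    and g: "\<And>v. b \<le> v \<Longrightarrow> v \<le> a \<Longrightarrow> (g has_real_derivative g' v) (at v)"
    and le: "\<And>v. b \<le> v \<Longrightarrow> v \<le> a \<Longrightarrow> f' v \<le> g' v"
  shows "f a - f b \<le> g a - g b"
proof -
  have "(\<lambda>v. g v - f v) b \<le> (\<lambda>v. g v - f v) a"
  proof (rule DERIV_nonneg_imp_nondecreasing[OF \<open>b \<le> a\<close>])
    fix v assume v: "b \<le> v" "v \<le> a"
    show "\<exists>y. ((\<lambda>v. g v - f v) has_real_derivative y) (at v) \<and> 0 \<le> y"
      by (rule exI[of _ "g' v - f' v"]) (use DERIV_diff[OF g[OF v] f[OF v]] le[OF v] in simp)
  qed
  then show ?thesis by simp
qed

lemma abs_difference_le_of_derivative_le: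
  fixes f g f' g' :: "real \<Rightarrow> real"
  assumes "b \<in> {0..1}" "a \<in> {0..1}"
    and f: "\<And>v. v \<in> {0..1} \<Longrightarrow> (f has_real_derivative f' v) (at v)"
    and g: "\<And>v. v \<in> {0..1} \<Longrightarrow> (g has_real_derivative g' v) (at v)"
    and le: "\<And>v. v \<in> {0..1} \<Longrightarrow> \<bar>f' v\<bar> \<le> g' v"
  shows "\<bar>f a - f b\<bar> \<le> \<bar>g a - g b\<bar>"
proof -
  have *: "\<bar>f y - f x\<bar> \<le> g y - g x" if "x \<in> {0..1}" "y \<in> {0..1}" "x \<le> y" for x y
  proof -
    have I: "v \<in> {0..1}" if "x \<le> v" "v \<le> y" for v
      using that \<open>x \<in> {0..1}\<close> \<open>y \<in> {0..1}\<close> by simp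
    have le': "f' v \<le> g' v" "- f' v \<le> g' v" if "v \<in> {0..1}" for v
      using le[OF that] by linarith+
    have "f y - f x \<le> g y - g x"
      by (rule difference_le_of_derivative_le[OF \<open>x \<le> y\<close> f[OF I] g[OF I] le'(1)[OF I]])
    moreover have "- f y - - f x \<le> g y - g x"
      by (rule difference_le_of_derivative_le[OF \<open>x \<le> y\<close> DERIV_minus[OF f[OF I]] g[OF I] le'(2)[OF I]])
    ultimately show ?thesis by linarith
  qed
  show ?thesis using *[OF assms(1,2)] *[OF assms(2,1)] by linarith
qed

section \<open>The double-well potential and its primitive\<close>

lemma W_eq: "W v = (v * (1 - v))\<^sup>2"
  by (simp add: W_def power_mult_distrib)

lemma DERIV_W: "(W has_real_derivative 2 * (v * (1 - v)) * (1 - 2 * v)) (at v)"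
  unfolding W_def[abs_def]
  by (auto intro!: derivative_eq_intros simp: algebra_simps power2_eq_square)

lemma sqrt_2W: "sqrt (2 * W v) = sqrt 2 * \<bar>v * (1 - v)\<bar>"
  by (simp add: W_eq real_sqrt_mult)

lemma bump_bounds:
  fixes v :: real
  assumes "v \<in> {0..1}"
  shows "0 \<le> v * (1 - v)" "v * (1 - v) \<le> 1/4"
proof -
  show "0 \<le> v * (1 - v)" using assms by simp
  have "0 \<le> (v - 1/2)\<^sup>2" by simp
  then show "v * (1 - v) \<le> 1/4" by (simp add: power2_eq_square algebra_simps)
qed

lemma continuous_sqrt_2W: "continuous_on UNIV (\<lambda>s. sqrt (2 * W s))"
  unfolding W_def by (intro continuous_intros)

lemma DERIV_phi: "(phi has_real_derivative sqrt (2 * W v)) (at v)"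
  using has_real_derivative_integral_from_0[OF continuous_sqrt_2W]
  unfolding phi_def[abs_def] .

lemma phi_0: "phi 0 = 0"
  by (simp add: phi_def)

lemma continuous_phi: "continuous_on UNIV phi"
  using DERIV_phi by (intro DERIV_continuous_on) (auto intro: has_field_derivative_at_within)

lemma phi_bounds:
  assumes "v \<in> {0..1}"
  shows "0 \<le> phi v" "phi v \<le> sigma" "sigma \<le> 1"
proof -
  have mono: "0 \<le> phi a - phi b" if "b \<le> a" for a b
    using difference_le_of_derivative_le[OF that, of "\<lambda>_. 0" "\<lambda>_. 0" phi "\<lambda>v. sqrt (2 * W v)"]
      DERIV_phi by (simp add: W_eq)
  show "0 \<le> phi v" using mono[of 0 v] assms by (simp add: phi_0)
  show "phi v \<le> sigma" using mono[of v 1] assms by (simp add: sigma_def)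
  have "phi 1 - phi 0 \<le> (\<lambda>v. v) 1 - (\<lambda>v. v) (0::real)"
  proof (rule difference_le_of_derivative_le[OF _ DERIV_phi DERIV_ident])
    fix v :: real assume "0 \<le> v" "v \<le> 1"
    then have "v * (1 - v) \<le> 1/4" "0 \<le> v * (1 - v)" using bump_bounds[of v] by auto
    moreover have "sqrt 2 \<le> 2" by (rule real_le_lsqrt) auto
    ultimately show "sqrt (2 * W v) \<le> 1"
      unfolding sqrt_2W using mult_mono[of "sqrt 2" 2 "v * (1 - v)" "1/4"] by simp
  qed simp
  then show "sigma \<le> 1" by (simp add: sigma_def phi_0)
qed

section \<open>The perturbed profile\<close>

text \<open>The barrier is the upper bound for \<open>\<epsilon>\<close> times the discrepancy. Its size is \<open>\<eta>\<close>, and it is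
  concave in \<open>v\<close> and increasing in \<open>v (1 - v)\<close>; these two properties make its drift decrease along the
  profile.\<close>

definition barrier :: "real \<Rightarrow> real \<Rightarrow> real" where
  "barrier \<eta> v = \<eta> * (1 + v * (1 - v))"

text \<open>A profile \<open>q\<close> with \<open>q' = slope \<eta> q\<close> solves \<open>q'' = W' q + G' q\<close>, where \<open>G\<close> is the barrier. It
  perturbs the standing wave of \<open>W\<close> and, unlike the wave, never becomes flat.\<close>

definition slope :: "real \<Rightarrow> real \<Rightarrow> real" where
  "slope \<eta> v = sqrt (2 * (W v + barrier \<eta> v))"

text \<open>The inverse of the profile with slope \<open>slope \<eta>\<close> and value \<open>0\<close> at \<open>0\<close>.\<close>

definition straighten :: "real \<Rightarrow> real \<Rightarrow> real" where
  "straighten \<eta> u = (LBINT s=ereal 0..ereal u. 1 / slope \<eta> s)"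

lemma W_barrier_pos:
  assumes "0 < \<eta>" "\<eta> \<le> 1"
  shows "0 < W v + barrier \<eta> v"
proof -
  \<comment> \<open>Positivity must hold on the whole line, where \<open>v (1 - v)\<close> may be negative; completing the
    square shows that it does as long as \<open>\<eta> < 4\<close>.\<close>
  have "W v + barrier \<eta> v = (v * (1 - v) + \<eta> / 2)\<^sup>2 + \<eta> * (1 - \<eta> / 4)"
    by (simp add: W_eq barrier_def power2_eq_square algebra_simps)
  moreover have "0 < \<eta> * (1 - \<eta> / 4)" using assms by simp
  ultimately show ?thesis by (smt (verit) zero_le_power2)
qed

lemma slope_pos: "0 < \<eta> \<Longrightarrow> \<eta> \<le> 1 \<Longrightarrow> 0 < slope \<eta> v"
  using W_barrier_pos[of \<eta> v] by (simp add: slope_def)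

lemma slope_square: "0 < \<eta> \<Longrightarrow> \<eta> \<le> 1 \<Longrightarrow> (slope \<eta> v)\<^sup>2 = 2 * (W v + barrier \<eta> v)"
  using W_barrier_pos[of \<eta> v] by (simp add: slope_def)

lemma DERIV_slope:
  assumes "0 < \<eta>" "\<eta> \<le> 1"
  shows "(slope \<eta> has_real_derivative (1 - 2 * v) * (2 * (v * (1 - v)) + \<eta>) / slope \<eta> v) (at v)"
proof -
  define X where "X = (1 - 2 * v) * (2 * (v * (1 - v)) + \<eta>)"
  have "(barrier \<eta> has_real_derivative \<eta> * (1 - 2 * v)) (at v)"
    unfolding barrier_def[abs_def] by (auto intro!: derivative_eq_intros simp: algebra_simps)
  from DERIV_cmult[OF DERIV_add[OF DERIV_W this], of 2]
  have "((\<lambda>v. 2 * (W v + barrier \<eta> v)) has_real_derivative 2 * X) (at v)"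
    by (simp add: X_def algebra_simps)
  from DERIV_chain2[OF DERIV_real_sqrt this] W_barrier_pos[OF assms, of v]
  have "((\<lambda>v. sqrt (2 * (W v + barrier \<eta> v))) has_real_derivative
     inverse (slope \<eta> v) / 2 * (2 * X)) (at v)"
    unfolding slope_def by simp
  also have "inverse (slope \<eta> v) / 2 * (2 * X) = X / slope \<eta> v"
    by (simp add: field_simps)
  finally show ?thesis unfolding slope_def[abs_def] X_def .
qed

lemma DERIV_straighten:
  assumes "0 < \<eta>" "\<eta> \<le> 1"
  shows "(straighten \<eta> has_real_derivative 1 / slope \<eta> v) (at v)"
proof -
  have "continuous_on UNIV (slope \<eta>)"
    using DERIV_slope[OF assms] by (intro DERIV_continuous_on) (auto intro: has_field_derivative_at_within)
  then have "continuous_on UNIV (\<lambda>s. 1 / slope \<eta> s)"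
    using slope_pos[OF assms] by (intro continuous_intros) (auto simp: less_imp_neq[symmetric])
  from has_real_derivative_integral_from_0[OF this] show ?thesis
    unfolding straighten_def[abs_def] .
qed

lemma strict_mono_straighten:
  assumes "0 < \<eta>" "\<eta> \<le> 1" "straighten \<eta> b < straighten \<eta> a"
  shows "b < a"
proof (rule ccontr)
  assume "\<not> b < a"
  then have "a \<le> b" by simp
  have "\<exists>y. (straighten \<eta> has_real_derivative y) (at v) \<and> 0 \<le> y" for v
    by (rule exI[of _ "1 / slope \<eta> v"])
      (simp add: DERIV_straighten[OF assms(1,2)] less_imp_le[OF slope_pos[OF assms(1,2)]])
  then have "straighten \<eta> a \<le> straighten \<eta> b"
    by (rule DERIV_nonneg_imp_nondecreasing[OF \<open>a \<le> b\<close>])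
  with assms(3) show False by simp
qed

text \<open>The gain that drives the whole estimate. Write \<open>w = v (1 - v)\<close>, \<open>G\<close> for the barrier, \<open>S\<close> for the
  slope and \<open>P\<close> for its straightening. Along the profile, that is, with respect to \<open>P\<close>, the drift
  \<open>G'/S\<close> has derivative \<open>G'' - G' (W' + G') / S\<^sup>2\<close>. Here \<open>G'' = - 2 \<eta>\<close> measures the concavity of the
  barrier, and \<open>G' (W' + G') \<ge> 0\<close> because \<open>W\<close> and \<open>G\<close> are both increasing functions of \<open>w\<close> on \<open>[0,1]\<close>.\<close>

lemma barrier_drift_decreases:
  assumes "0 < \<eta>" "\<eta> \<le> 1" "0 \<le> b" "b \<le> a" "a \<le> 1"
  shows "\<eta> * (1 - 2 * a) / slope \<eta> a - \<eta> * (1 - 2 * b) / slope \<eta> b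
     \<le> - 2 * \<eta> * straighten \<eta> a - (- 2 * \<eta> * straighten \<eta> b)"
proof (rule difference_le_of_derivative_le[OF \<open>b \<le> a\<close>])
  fix v assume v: "b \<le> v" "v \<le> a"
  let ?S = "slope \<eta> v"
  let ?S' = "(1 - 2 * v) * (2 * (v * (1 - v)) + \<eta>) / ?S"
  have S: "?S > 0" using slope_pos assms by blast
  show "((\<lambda>v. \<eta> * (1 - 2 * v) / slope \<eta> v) has_real_derivative
      (- 2 * \<eta> * ?S - \<eta> * (1 - 2 * v) * ?S') / ?S\<^sup>2) (at v)"
    using S DERIV_slope[OF assms(1,2), of v]
    by (auto intro!: derivative_eq_intros simp: power2_eq_square algebra_simps)
  show "((\<lambda>v. - 2 * \<eta> * straighten \<eta> v) has_real_derivative - 2 * \<eta> * (1 / ?S)) (at v)"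
    by (intro DERIV_cmult DERIV_straighten assms)
  have "0 \<le> v * (1 - v)" using v assms by simp
  then have "0 \<le> \<eta> * (1 - 2 * v)\<^sup>2 * (2 * (v * (1 - v)) + \<eta>) / ?S"
    using S assms by (intro divide_nonneg_pos mult_nonneg_nonneg) auto
  also have "\<dots> = \<eta> * (1 - 2 * v) * ?S'" by (simp add: power2_eq_square)
  finally have "(- 2 * \<eta> * ?S - \<eta> * (1 - 2 * v) * ?S') / ?S\<^sup>2 \<le> (- 2 * \<eta> * ?S) / ?S\<^sup>2"
    by (intro divide_right_mono) auto
  also have "\<dots> = - 2 * \<eta> * (1 / ?S)" using S by (simp add: power2_eq_square)
  finally show "(- 2 * \<eta> * ?S - \<eta> * (1 - 2 * v) * ?S') / ?S\<^sup>2 \<le> - 2 * \<eta> * (1 / ?S)" .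
qed

text \<open>The quotient of the two derivatives is \<open>sqrt (2 W) S\<close>, which is at most \<open>1\<close> on \<open>[0,1]\<close>.\<close>

lemma phi_difference_le:
  assumes "0 < \<eta>" "\<eta> \<le> 1" "a \<in> {0..1}" "b \<in> {0..1}"
  shows "\<bar>phi a - phi b\<bar> \<le> \<bar>straighten \<eta> a - straighten \<eta> b\<bar>"
proof (rule abs_difference_le_of_derivative_le[OF assms(4,3) DERIV_phi DERIV_straighten[OF assms(1,2)]])
  fix v :: real assume v: "v \<in> {0..1}"
  let ?w = "v * (1 - v)"
  note w = bump_bounds[OF v]
  have "?w\<^sup>2 \<le> (1/4)\<^sup>2" by (rule power_mono) (use w in auto)
  then have Wle: "W v \<le> 1/16" by (simp add: W_eq power2_eq_square)
  have "barrier \<eta> v \<le> 1 * (1 + 1/4)"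
    unfolding barrier_def using w assms by (intro mult_mono) auto
  then have "2 * (W v + barrier \<eta> v) \<le> 4" using Wle by simp
  then have "slope \<eta> v \<le> 2" unfolding slope_def by (intro real_le_lsqrt) auto
  moreover have "sqrt (2 * W v) \<le> 1/2"
    by (rule real_le_lsqrt) (use Wle in \<open>auto simp: W_eq power2_eq_square\<close>)
  ultimately have "sqrt (2 * W v) * slope \<eta> v \<le> (1/2) * 2"
    using slope_pos[OF assms(1,2), of v] by (intro mult_mono) (auto simp: W_eq)
  then show "\<bar>sqrt (2 * W v)\<bar> \<le> 1 / slope \<eta> v"
    using slope_pos[OF assms(1,2), of v] by (simp add: pos_le_divide_eq W_eq)
qed

text \<open>With \<open>w = v (1 - v)\<close>, the derivative of the mobility \<open>sqrt (2 W) / S\<close> with respect to the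
  straightened variable is \<open>sqrt 2 (1 - 2 v) \<eta> (2 + w) / S\<^sup>2\<close>. As \<open>S\<^sup>2 \<ge> \<eta> (2 + w)\<close>, the factor \<open>\<eta>\<close>
  cancels, and the Lipschitz constant does not depend on it.\<close>

lemma mobility_difference_le:
  assumes "0 < \<eta>" "\<eta> \<le> 1" "a \<in> {0..1}" "b \<in> {0..1}"
  shows "\<bar>sqrt (2 * W a) / slope \<eta> a - sqrt (2 * W b) / slope \<eta> b\<bar>
     \<le> \<bar>2 * straighten \<eta> a - 2 * straighten \<eta> b\<bar>"
proof -
  let ?w = "\<lambda>v::real. v * (1 - v)"
  let ?R = "\<lambda>v. W v + barrier \<eta> v"
  let ?k = "\<lambda>v. sqrt 2 * ?w v / slope \<eta> v"
  have "\<bar>?k a - ?k b\<bar> \<le> \<bar>2 * straighten \<eta> a - 2 * straighten \<eta> b\<bar>"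
  proof (rule abs_difference_le_of_derivative_le[OF assms(4,3)])
    fix v :: real assume v: "v \<in> {0..1}"
    note w = bump_bounds[OF v]
    let ?S = "slope \<eta> v"
    let ?S' = "(1 - 2 * v) * (2 * ?w v + \<eta>) / ?S"
    have S: "?S > 0" using slope_pos assms by blast
    have S2: "?S\<^sup>2 = 2 * ?R v" using slope_square assms by blast
    show "(?k has_real_derivative
        sqrt 2 * ((1 - 2 * v) * ?S - ?w v * ?S') / ?S\<^sup>2) (at v)"
      using S DERIV_slope[OF assms(1,2), of v]
      by (auto intro!: derivative_eq_intros simp: power2_eq_square algebra_simps)
    show "((\<lambda>v. 2 * straighten \<eta> v) has_real_derivative 2 * (1 / ?S)) (at v)"
      by (intro DERIV_cmult DERIV_straighten assms)
    have "((1 - 2 * v) * ?S - ?w v * ?S') * ?S = (1 - 2 * v) * (?S\<^sup>2 - ?w v * (2 * ?w v + \<eta>))"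
      using S by (simp add: field_simps power2_eq_square)
    also have "?S\<^sup>2 - ?w v * (2 * ?w v + \<eta>) = \<eta> * (2 + ?w v)"
      unfolding S2 by (simp add: W_eq barrier_def power2_eq_square algebra_simps)
    finally have num: "((1 - 2 * v) * ?S - ?w v * ?S') * ?S = (1 - 2 * v) * (\<eta> * (2 + ?w v))" .
    have "\<eta> * (2 + ?w v) \<le> ?S\<^sup>2"
    proof -
      have "0 \<le> W v" "0 \<le> \<eta> * ?w v" using w assms by (auto simp: W_eq)
      then have "\<eta> * (2 + ?w v) \<le> 2 * W v + \<eta> * (2 + ?w v) + \<eta> * ?w v" by linarith
      also have "\<dots> = ?S\<^sup>2" unfolding S2 by (simp add: barrier_def algebra_simps)
      finally show ?thesis .
    qed
    moreover have "0 \<le> \<eta> * (2 + ?w v)" using w assms by (intro mult_nonneg_nonneg) auto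
    ultimately have "\<bar>1 - 2 * v\<bar> * (\<eta> * (2 + ?w v)) \<le> 1 * ?S\<^sup>2"
      using v by (intro mult_mono) auto
    then have "\<bar>((1 - 2 * v) * ?S - ?w v * ?S') * ?S\<bar> \<le> ?S\<^sup>2"
      unfolding num by (simp only: abs_mult[of "1 - 2 * v"] abs_of_nonneg[OF \<open>0 \<le> \<eta> * (2 + ?w v)\<close>] mult_1)
    then have "\<bar>(1 - 2 * v) * ?S - ?w v * ?S'\<bar> \<le> ?S"
      using S by (simp add: abs_mult power2_eq_square)
    moreover have "sqrt 2 \<le> 2" by (rule real_le_lsqrt) auto
    ultimately have "sqrt 2 * \<bar>(1 - 2 * v) * ?S - ?w v * ?S'\<bar> \<le> 2 * ?S"
      by (intro mult_mono) auto
    then have "sqrt 2 * \<bar>(1 - 2 * v) * ?S - ?w v * ?S'\<bar> / ?S\<^sup>2 \<le> 2 * ?S / ?S\<^sup>2"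
      by (intro divide_right_mono) auto
    moreover have "2 * ?S / ?S\<^sup>2 = 2 * (1 / ?S)" using S by (simp add: power2_eq_square)
    ultimately show "\<bar>sqrt 2 * ((1 - 2 * v) * ?S - ?w v * ?S') / ?S\<^sup>2\<bar> \<le> 2 * (1 / ?S)"
      by (simp add: abs_mult)
  qed
  moreover have "sqrt (2 * W v) = sqrt 2 * ?w v" if "v \<in> {0..1}" for v
    using bump_bounds(1)[OF that] by (simp only: sqrt_2W abs_of_nonneg)
  ultimately show ?thesis using assms(3,4) by simp
qed

lemma mobility_bounds:
  assumes "0 < \<eta>" "\<eta> \<le> 1" "v \<in> {0..1}"
  shows "\<bar>sqrt (2 * W v) / slope \<eta> v\<bar> \<le> 1"
proof -
  have "0 \<le> barrier \<eta> v"
    unfolding barrier_def using bump_bounds(1)[OF assms(3)] assms by (intro mult_nonneg_nonneg) auto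
  then have "sqrt (2 * W v) \<le> slope \<eta> v" unfolding slope_def by simp
  then show ?thesis using slope_pos[OF assms(1,2), of v] by (simp add: pos_divide_le_eq W_eq)
qed

section \<open>The reaction term at two points\<close>

definition volume_defect :: "real ^ 'n \<Rightarrow> real" where
  "volume_defect a = sigma - (\<Sum>j\<in>UNIV. phi (a $ j))"

lemma volume_defect_bound:
  fixes a :: "real ^ 'n"
  assumes "\<And>j. a $ j \<in> {0..1}"
  shows "\<bar>volume_defect a\<bar> \<le> real CARD('n)"
proof -
  have s: "0 \<le> sigma" "sigma \<le> 1" using phi_bounds[of 1] by (auto simp: sigma_def)
  have "0 \<le> (\<Sum>j\<in>UNIV. phi (a $ j))" using phi_bounds assms by (intro sum_nonneg) auto
  moreover have "(\<Sum>j\<in>UNIV. phi (a $ j)) \<le> (\<Sum>j\<in>(UNIV::'n set). 1)"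
    using phi_bounds(2)[OF assms] s(2) by (intro sum_mono) (rule order_trans)
  then have "(\<Sum>j\<in>UNIV. phi (a $ j)) \<le> real CARD('n)" by simp
  moreover have "1 \<le> real CARD('n)" by (simp add: Suc_leI)
  ultimately show ?thesis unfolding volume_defect_def using s by linarith
qed

text \<open>The coupling between the components changes by at most \<open>3 n \<delta> d\<close>, where \<open>d\<close> is the largest
  difference of the straightened components: the mobility and \<open>phi\<close> are Lipschitz in the straightened
  variables. The drift of the barrier decreases by at least \<open>2 \<eta> d \<ge> 4 n \<delta> d\<close>. It is essential that the
  component \<open>i\<close> realizes the largest difference, since the coupling involves all components.\<close>

lemma reaction_strictly_decreases:
  fixes a b :: "real ^ 'n"
  assumes \<eta>: "0 < \<eta>" "\<eta> \<le> 1"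
    and \<delta>: "0 < \<delta>" "2 * real CARD('n) * \<delta> \<le> \<eta>"
    and a: "\<And>j. a $ j \<in> {0..1}" and b: "\<And>j. b $ j \<in> {0..1}"
    and D: "0 < straighten \<eta> (a $ i) - straighten \<eta> (b $ i)"
    and le: "\<And>j. \<bar>straighten \<eta> (a $ j) - straighten \<eta> (b $ j)\<bar>
       \<le> straighten \<eta> (a $ i) - straighten \<eta> (b $ i)"
  shows "\<eta> * (1 - 2 * a $ i) / slope \<eta> (a $ i)
      + \<delta> * (sqrt (2 * W (a $ i)) / slope \<eta> (a $ i)) * volume_defect a
    < \<eta> * (1 - 2 * b $ i) / slope \<eta> (b $ i)
      + \<delta> * (sqrt (2 * W (b $ i)) / slope \<eta> (b $ i)) * volume_defect b"
proof -
  define n where "n = real CARD('n)"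
  define d where "d = straighten \<eta> (a $ i) - straighten \<eta> (b $ i)"
  define k where "k v = sqrt (2 * W v) / slope \<eta> v" for v
  have d: "0 < d" using D by (simp add: d_def)
  have n: "0 < n" by (simp add: n_def)
  have "b $ i < a $ i" by (rule strict_mono_straighten[OF \<eta>]) (use D in simp)
  then have drift: "\<eta> * (1 - 2 * a $ i) / slope \<eta> (a $ i) - \<eta> * (1 - 2 * b $ i) / slope \<eta> (b $ i)
     \<le> - 2 * \<eta> * d"
    using barrier_drift_decreases[OF \<eta>, of "b $ i" "a $ i"] a[of i] b[of i]
    by (simp add: d_def algebra_simps)
  have k: "\<bar>k (a $ i) - k (b $ i)\<bar> \<le> 2 * d"
    using mobility_difference_le[OF \<eta> a[of i] b[of i]] d unfolding k_def d_def by simp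
  have "\<bar>volume_defect a - volume_defect b\<bar> = \<bar>\<Sum>j\<in>UNIV. phi (b $ j) - phi (a $ j)\<bar>"
    by (simp add: volume_defect_def sum_subtractf)
  also have "\<dots> \<le> (\<Sum>j\<in>UNIV. \<bar>phi (b $ j) - phi (a $ j)\<bar>)" by (rule sum_abs)
  also have "\<dots> \<le> (\<Sum>j\<in>(UNIV::'n set). d)"
  proof (rule sum_mono)
    fix j :: 'n
    have "\<bar>phi (a $ j) - phi (b $ j)\<bar> \<le> d"
      unfolding d_def by (rule order_trans[OF phi_difference_le[OF \<eta> a b] le])
    then show "\<bar>phi (b $ j) - phi (a $ j)\<bar> \<le> d" by linarith
  qed
  also have "\<dots> = n * d" by (simp add: n_def)
  finally have g: "\<bar>volume_defect a - volume_defect b\<bar> \<le> n * d" .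
  have "k (a $ i) * volume_defect a - k (b $ i) * volume_defect b
    = (k (a $ i) - k (b $ i)) * volume_defect a + k (b $ i) * (volume_defect a - volume_defect b)"
    by (simp add: algebra_simps)
  also have "\<dots> \<le> (2 * d) * n + 1 * (n * d)"
  proof (rule add_mono)
    have "\<bar>(k (a $ i) - k (b $ i)) * volume_defect a\<bar> \<le> (2 * d) * n"
      unfolding abs_mult using k d volume_defect_bound[OF a] n_def by (intro mult_mono) auto
    then show "(k (a $ i) - k (b $ i)) * volume_defect a \<le> (2 * d) * n" by linarith
    have "\<bar>k (b $ i) * (volume_defect a - volume_defect b)\<bar> \<le> 1 * (n * d)"
      unfolding abs_mult using g mobility_bounds[OF \<eta> b] unfolding k_def by (intro mult_mono) auto
    then show "k (b $ i) * (volume_defect a - volume_defect b) \<le> 1 * (n * d)" by linarith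
  qed
  finally have "\<delta> * (k (a $ i) * volume_defect a - k (b $ i) * volume_defect b) \<le> \<delta> * (3 * n * d)"
    using \<delta>(1) by (intro mult_left_mono) (auto simp: algebra_simps)
  also have "\<dots> < \<delta> * (4 * n * d)" using \<delta>(1) n d by simp
  also have "\<dots> = 2 * d * (2 * n * \<delta>)" by simp
  also have "\<dots> \<le> 2 * d * \<eta>" using \<delta>(2) d by (intro mult_left_mono) (auto simp: n_def)
  finally show ?thesis using drift unfolding k_def by (simp add: algebra_simps)
qed

section \<open>Gradients, Laplacians and derivative tests\<close>

lemma has_derivative_grad:
  fixes f :: "real ^ 'd \<Rightarrow> real"
  assumes "f differentiable (at x)"
  shows "(f has_derivative (\<lambda>h. grad f x \<bullet> h)) (at x)"
proof -
  let ?D = "frechet_derivative f (at x)"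
  have D: "(f has_derivative ?D) (at x)" using assms frechet_derivative_works by blast
  then have lin: "linear ?D" by (rule has_derivative_linear)
  have "?D h = grad f x \<bullet> h" for h
  proof -
    have "?D h = ?D (\<Sum>j\<in>UNIV. h $ j *\<^sub>R axis j 1)"
      using basis_expansion[of h] by (simp add: scalar_mult_eq_scaleR)
    also have "\<dots> = (\<Sum>j\<in>UNIV. h $ j * ?D (axis j 1))"
      by (simp add: linear_sum[OF lin] linear_cmul[OF lin])
    also have "\<dots> = grad f x \<bullet> h" by (simp add: grad_def inner_vec_def mult.commute)
    finally show ?thesis .
  qed
  then have "?D = (\<lambda>h. grad f x \<bullet> h)" by (rule ext)
  with D show ?thesis by metis
qed

lemma grad_eqI:
  fixes f :: "real ^ 'd \<Rightarrow> real"
  assumes "(f has_derivative (\<lambda>h. a \<bullet> h)) (at x)"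
  shows "grad f x = a"
  unfolding grad_def frechet_derivative_at[OF assms, symmetric]
  by (simp add: inner_axis vec_eq_iff)

lemma laplacian_eq_sum:
  "laplacian f x = (\<Sum>k\<in>UNIV. frechet_derivative (grad f) (at x) (axis k 1) $ k)"
  by (simp add: laplacian_def trace_def jacobian_def matrix_def)

lemma grad_compose:
  fixes v :: "real ^ 'd \<Rightarrow> real"
  assumes "(P has_real_derivative p) (at (v x))" "v differentiable (at x)"
  shows "((\<lambda>y. P (v y)) has_derivative (\<lambda>h. (p *\<^sub>R grad v x) \<bullet> h)) (at x)"
    "grad (\<lambda>y. P (v y)) x = p *\<^sub>R grad v x"
proof -
  show "((\<lambda>y. P (v y)) has_derivative (\<lambda>h. (p *\<^sub>R grad v x) \<bullet> h)) (at x)"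
    using has_derivative_compose[OF has_derivative_grad[OF assms(2)]
        has_field_derivative_imp_has_derivative[OF assms(1)]] by simp
  then show "grad (\<lambda>y. P (v y)) x = p *\<^sub>R grad v x" by (rule grad_eqI)
qed

lemma laplacian_compose:
  fixes v :: "real ^ 'd \<Rightarrow> real"
  assumes P: "\<And>s. (P has_real_derivative P' s) (at s)"
    and P': "(P' has_real_derivative p) (at (v x))"
    and v: "\<And>y. v differentiable (at y)" and v': "grad v differentiable (at x)"
  shows "grad (\<lambda>y. P (v y)) differentiable (at x)"
    "laplacian (\<lambda>y. P (v y)) x = P' (v x) * laplacian v x + p * (norm (grad v x))\<^sup>2"
proof -
  let ?H = "frechet_derivative (grad v) (at x)"
  have H: "(grad v has_derivative ?H) (at x)" using v' frechet_derivative_works by blast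
  have eq: "grad (\<lambda>y. P (v y)) = (\<lambda>y. P' (v y) *\<^sub>R grad v y)"
    by (rule ext, rule grad_compose(2)[OF P v])
  have D: "(grad (\<lambda>y. P (v y)) has_derivative
      (\<lambda>h. P' (v x) *\<^sub>R ?H h + ((p *\<^sub>R grad v x) \<bullet> h) *\<^sub>R grad v x)) (at x)"
    unfolding eq by (rule has_derivative_scaleR[OF grad_compose(1)[where v = v, OF P' v] H])
  then show "grad (\<lambda>y. P (v y)) differentiable (at x)" by (rule differentiableI)
  have "laplacian (\<lambda>y. P (v y)) x
    = (\<Sum>k\<in>UNIV. P' (v x) * ?H (axis k 1) $ k + p * (grad v x $ k * grad v x $ k))"
    unfolding laplacian_eq_sum frechet_derivative_at[OF D, symmetric]
    by (simp add: inner_axis mult.assoc)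
  also have "\<dots> = P' (v x) * laplacian v x + p * (grad v x \<bullet> grad v x)"
    by (simp add: laplacian_eq_sum sum.distrib sum_distrib_left inner_vec_def)
  finally show "laplacian (\<lambda>y. P (v y)) x = P' (v x) * laplacian v x + p * (norm (grad v x))\<^sup>2"
    by (simp add: power2_norm_eq_inner)
qed

text \<open>If \<open>c\<close> were positive, then \<open>h'\<close>, which vanishes at \<open>0\<close>, would be positive just to the right of \<open>0\<close>,
  and \<open>h\<close> would increase there.\<close>

lemma second_derivative_nonpos_at_maximum:
  fixes h :: "real \<Rightarrow> real"
  assumes h: "\<And>s. (h has_real_derivative h' s) (at s)"
    and h': "(h' has_real_derivative c) (at 0)"
    and max: "\<And>s. h s \<le> h 0"
  shows "c \<le> 0"
proof (rule ccontr)
  assume "\<not> c \<le> 0"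
  then obtain d where d: "d > 0" "\<And>s. 0 < s \<Longrightarrow> s < d \<Longrightarrow> h' 0 < h' (0 + s)"
    using DERIV_pos_inc_right[OF h'] by force
  have "h' 0 = 0" by (rule DERIV_local_max[OF h zero_less_one]) (use max in auto)
  obtain s where "0 < s" "s < d / 2" "h (d / 2) - h 0 = (d / 2 - 0) * h' s"
    using MVT2[of 0 "d / 2" h h'] h d(1) by auto
  moreover have "0 < h' s" using d(2)[of s] \<open>h' 0 = 0\<close> calculation d(1) by simp
  ultimately have "h 0 < h (d / 2)" using d(1) by (smt (verit) mult_pos_pos half_gt_zero)
  with max[of "d / 2"] show False by simp
qed

text \<open>Along each coordinate axis, the difference of the translates has a maximum at \<open>h = 0\<close>, so its pure
  second derivative is nonpositive there; these derivatives add up to the difference of the Laplacians.\<close>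

lemma laplacian_le_if_translates_le:
  fixes f g :: "real ^ 'd \<Rightarrow> real"
  assumes f: "\<And>z. f differentiable (at z)" "grad f differentiable (at x)"
    and g: "\<And>z. g differentiable (at z)" "grad g differentiable (at y)"
    and le: "\<And>h. f (x + h) - g (y + h) \<le> f x - g y"
  shows "laplacian f x \<le> laplacian g y"
proof -
  have line: "((\<lambda>s. f (z + s *\<^sub>R axis k 1)) has_real_derivative grad f (z + s *\<^sub>R axis k 1) $ k) (at s)"
    if "\<And>z. f differentiable (at z)" for f :: "real ^ 'd \<Rightarrow> real" and z k s
  proof -
    have "((\<lambda>s. z + s *\<^sub>R axis k 1) has_derivative (\<lambda>s. s *\<^sub>R axis k 1)) (at s)"
      by (auto intro!: derivative_eq_intros)
    from has_derivative_compose[OF this has_derivative_grad[OF that]]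
    have "((\<lambda>s. f (z + s *\<^sub>R axis k 1)) has_derivative
        (\<lambda>h. grad f (z + s *\<^sub>R axis k 1) \<bullet> (h *\<^sub>R axis k 1))) (at s)" .
    moreover have "(\<lambda>h. grad f (z + s *\<^sub>R axis k 1) \<bullet> (h *\<^sub>R axis k 1))
        = (*) (grad f (z + s *\<^sub>R axis k 1) $ k)"
      by (rule ext) (simp add: inner_axis mult.commute)
    ultimately show ?thesis unfolding has_field_derivative_def by simp
  qed
  have line': "((\<lambda>s. grad f (z + s *\<^sub>R axis k 1) $ k) has_real_derivative
      frechet_derivative (grad f) (at z) (axis k 1) $ k) (at 0)"
    if "grad f differentiable (at z)" for f :: "real ^ 'd \<Rightarrow> real" and z k
  proof -
    let ?H = "frechet_derivative (grad f) (at z)"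
    have H: "(grad f has_derivative ?H) (at z)" using that frechet_derivative_works by blast
    have "((\<lambda>s. z + s *\<^sub>R axis k 1) has_derivative (\<lambda>s. s *\<^sub>R axis k 1)) (at 0)"
      by (auto intro!: derivative_eq_intros)
    from has_derivative_compose[OF this, of "grad f" ?H] H
    have "((\<lambda>s. grad f (z + s *\<^sub>R axis k 1)) has_derivative (\<lambda>s. ?H (s *\<^sub>R axis k 1))) (at 0)"
      by simp
    from bounded_linear.has_derivative[OF bounded_linear_vec_nth this, of k]
    have "((\<lambda>s. grad f (z + s *\<^sub>R axis k 1) $ k) has_derivative
        (\<lambda>s. ?H (s *\<^sub>R axis k 1) $ k)) (at 0)" .
    moreover have "(\<lambda>s. ?H (s *\<^sub>R axis k 1) $ k) = (*) (?H (axis k 1) $ k)"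
      by (rule ext) (simp add: linear_cmul[OF has_derivative_linear[OF H]] mult.commute)
    ultimately show ?thesis unfolding has_field_derivative_def by simp
  qed
  have "frechet_derivative (grad f) (at x) (axis k 1) $ k
    - frechet_derivative (grad g) (at y) (axis k 1) $ k \<le> 0" for k
    by (rule second_derivative_nonpos_at_maximum[OF
          DERIV_diff[OF line[OF f(1)] line[OF g(1)]] DERIV_diff[OF line'[OF f(2)] line'[OF g(2)]]])
      (use le in simp)
  then show ?thesis unfolding laplacian_eq_sum by (intro sum_mono) simp
qed

lemma laplacian_nonneg_at_minimum:
  fixes f :: "real ^ 'd \<Rightarrow> real"
  assumes "\<And>z. f differentiable (at z)" "grad f differentiable (at x)" "\<And>y. f x \<le> f y"
  shows "0 \<le> laplacian f x"
proof -
  have g: "grad (\<lambda>_::real ^ 'd. 0::real) = (\<lambda>_. 0)" by (simp add: grad_def fun_eq_iff vec_eq_iff)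
  have "laplacian (\<lambda>_. 0) x \<le> laplacian f x"
    by (rule laplacian_le_if_translates_le) (use assms in \<open>auto simp: g\<close>)
  moreover have "laplacian (\<lambda>_. 0) x = 0"
    unfolding laplacian_eq_sum g by simp
  ultimately show ?thesis by simp
qed

text \<open>The maximum is only taken over earlier times, so it may lie at the right end of a time interval.\<close>

lemma derivative_nonneg_at_last_maximum:
  fixes h :: "real \<Rightarrow> real"
  assumes h: "(h has_real_derivative c) (at t)" and "0 < t"
    and max: "\<And>s. 0 \<le> s \<Longrightarrow> s \<le> t \<Longrightarrow> h s \<le> h t"
  shows "0 \<le> c"
proof (rule ccontr)
  assume "\<not> 0 \<le> c"
  then obtain d where "d > 0" "\<forall>s>0. s < d \<longrightarrow> h t < h (t - s)"
    using DERIV_neg_dec_left[OF h] by auto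
  then have "h t < h (t - min t (d / 2))" using \<open>0 < t\<close> by (auto simp: min_def)
  moreover have "h (t - min t (d / 2)) \<le> h t" by (rule max) (use \<open>0 < t\<close> \<open>d > 0\<close> in auto)
  ultimately show False by simp
qed

lemma grad_at_separated_maximum:
  fixes f g :: "real ^ 'd \<Rightarrow> real"
  assumes "x \<noteq> y" "f differentiable (at x)"
    and max: "\<And>z. f z - L * norm (z - y) \<le> f x - L * norm (x - y)"
  shows "grad f x = L *\<^sub>R sgn (x - y)"
proof -
  have "((\<lambda>z. z - y) has_derivative (\<lambda>h. h)) (at x)" by (auto intro!: derivative_eq_intros)
  from has_derivative_compose[OF this has_derivative_norm] \<open>x \<noteq> y\<close>
  have n: "((\<lambda>z. norm (z - y)) has_derivative (\<lambda>h. sgn (x - y) \<bullet> h)) (at x)"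
    by (simp add: inner_commute)
  have D: "((\<lambda>z. f z - L * norm (z - y)) has_derivative
      (\<lambda>h. grad f x \<bullet> h - L * (sgn (x - y) \<bullet> h))) (at x)"
    by (intro has_derivative_diff has_derivative_grad assms has_derivative_mult_right n)
  have zero: "(\<lambda>h. grad f x \<bullet> h - L * (sgn (x - y) \<bullet> h)) = (\<lambda>h. 0)"
    by (rule differential_zero_maxmin[OF _ open_UNIV D]) (use max in auto)
  have "(grad f x - L *\<^sub>R sgn (x - y)) \<bullet> h = 0" for h
    using fun_cong[OF zero, of h] by (simp add: inner_diff_left)
  from this[of "grad f x - L *\<^sub>R sgn (x - y)"] have "grad f x - L *\<^sub>R sgn (x - y) = 0"
    by (simp only: inner_eq_zero_iff)
  then show ?thesis by simp
qed

lemma lipschitz_of_grad_bound: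
  fixes f :: "real ^ 'd \<Rightarrow> real"
  assumes "\<And>z. f differentiable (at z)" "\<And>z. norm (grad f z) \<le> L"
  shows "f x - f y \<le> L * norm (x - y)"
proof -
  have "norm (f x - f y) \<le> L * norm (x - y)"
  proof (rule differentiable_bound[OF convex_UNIV has_derivative_grad[OF assms(1)]])
    fix z
    show "onorm (\<lambda>h. grad f z \<bullet> h) \<le> L"
    proof (rule onorm_le)
      fix h
      have "norm (grad f z \<bullet> h) \<le> norm (grad f z) * norm h" by (simp add: Cauchy_Schwarz_ineq2)
      also have "\<dots> \<le> L * norm h" using assms(2) by (intro mult_right_mono) auto
      finally show "norm (grad f z \<bullet> h) \<le> L * norm h" .
    qed
  qed auto
  then show ?thesis by simp
qed

lemma grad_bound_of_lipschitz:
  fixes f :: "real ^ 'd \<Rightarrow> real"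
  assumes "f differentiable (at x)" "0 \<le> L" "\<And>z. f z - f x \<le> L * norm (z - x)"
  shows "norm (grad f x) \<le> L"
proof (rule ccontr)
  define a where "a = grad f x"
  assume "\<not> norm (grad f x) \<le> L"
  then have a: "L < norm a" by (simp add: a_def)
  have "((\<lambda>s. x + s *\<^sub>R a) has_derivative (\<lambda>s. s *\<^sub>R a)) (at 0)"
    by (auto intro!: derivative_eq_intros)
  from has_derivative_compose[OF this, of f "\<lambda>h. a \<bullet> h"] has_derivative_grad[OF assms(1)]
  have "((\<lambda>s. f (x + s *\<^sub>R a)) has_derivative (\<lambda>s. s * (a \<bullet> a))) (at 0)"
    by (simp add: a_def)
  then have "((\<lambda>s. f (x + s *\<^sub>R a)) has_real_derivative (norm a)\<^sup>2) (at 0)"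
    by (simp add: has_field_derivative_def power2_norm_eq_inner mult_commute_abs)
  from DERIV_diff[OF this DERIV_cmult_Id[of "L * norm a"]]
  have "((\<lambda>s. f (x + s *\<^sub>R a) - L * norm a * s) has_real_derivative
      (norm a)\<^sup>2 - L * norm a) (at 0)" .
  moreover have "L * norm a < norm a * norm a"
    by (rule mult_strict_right_mono[OF a]) (use a \<open>0 \<le> L\<close> in linarith)
  then have "0 < (norm a)\<^sup>2 - L * norm a" unfolding power2_eq_square by linarith
  ultimately obtain d where "d > 0" and
    d: "\<forall>s>0. s < d \<longrightarrow> f (x + 0 *\<^sub>R a) - L * norm a * 0 < f (x + (0 + s) *\<^sub>R a) - L * norm a * (0 + s)"
    using DERIV_pos_inc_right by blast
  then have "f x < f (x + (d / 2) *\<^sub>R a) - L * norm a * (d / 2)"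
    using d[rule_format, of "d / 2"] by simp
  moreover have "f (x + (d / 2) *\<^sub>R a) - f x \<le> L * norm a * (d / 2)"
    using assms(3)[of "x + (d / 2) *\<^sub>R a"] \<open>d > 0\<close> by (simp add: mult_ac)
  ultimately show False by simp
qed

section \<open>Periodic functions and a weak minimum principle\<close>

lemma periodic_representative:
  fixes f :: "real ^ 'd \<Rightarrow> 'b"
  assumes "torus_periodic f"
  shows "f (x - (\<chi> j. of_int (m j))) = f x"
proof -
  have nat: "f (y + real k *\<^sub>R axis j 1) = f y" for y j and k :: nat
  proof (induction k)
    case (Suc k)
    have "f ((y + real k *\<^sub>R axis j 1) + axis j 1) = f (y + real k *\<^sub>R axis j 1)"
      using assms unfolding torus_periodic_def by blast
    with Suc show ?case by (simp add: algebra_simps)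
  qed simp
  have int: "f (y + of_int k *\<^sub>R axis j 1) = f y" for y j and k :: int
  proof (cases "0 \<le> k")
    case True
    then show ?thesis using nat[of y "nat k" j] by simp
  next
    case False
    then show ?thesis using nat[of "y + of_int k *\<^sub>R axis j 1" "nat (- k)" j] by (simp add: algebra_simps)
  qed
  have "f (y + (\<Sum>j\<in>A. of_int (- m j) *\<^sub>R axis j 1)) = f y" if "finite A" for A y
    using that
  proof (induction A arbitrary: y rule: finite_induct)
    case (insert j A)
    then show ?case
      using insert.IH[of "y + of_int (- m j) *\<^sub>R axis j 1"] int[of y "- m j" j]
      by (simp add: algebra_simps)
  qed simp
  from this[of UNIV x] have "f (x + (\<Sum>j\<in>UNIV. of_int (- m j) *\<^sub>R axis j 1)) = f x" by simp
  moreover have "(\<Sum>j\<in>UNIV. of_int (- m j) *\<^sub>R axis j 1) = - (\<chi> j. real_of_int (m j))"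
    by (simp add: vec_eq_iff axis_def sum_negf if_distrib[of "\<lambda>z. _ * z"] cong: if_cong)
  ultimately show ?thesis by simp
qed

lemma unit_cube_representative:
  fixes x :: "real ^ 'd"
  obtains m where "x - (\<chi> j. of_int (m j)) \<in> cbox 0 (\<chi> j. 1)"
proof (rule that)
  have "0 \<le> x $ j - of_int \<lfloor>x $ j\<rfloor>" "x $ j - of_int \<lfloor>x $ j\<rfloor> \<le> 1" for j
    by linarith+
  then show "x - (\<chi> j. of_int \<lfloor>x $ j\<rfloor>) \<in> cbox 0 (\<chi> j. 1)"
    by (simp add: mem_box_cart)
qed

text \<open>Periodicity reduces the supremum over all of space to the closed unit cube, which is compact.\<close>

lemma bounded_if_periodic:
  fixes f :: "real \<Rightarrow> real ^ 'd \<Rightarrow> real"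
  assumes per: "\<And>t. 0 \<le> t \<Longrightarrow> torus_periodic (f t)"
    and cont: "continuous_on ({0..} \<times> UNIV) (\<lambda>(t, x). f t x)"
  obtains B where "0 \<le> B" "\<And>t x. 0 \<le> t \<Longrightarrow> t \<le> T \<Longrightarrow> \<bar>f t x\<bar> \<le> B"
proof -
  have "compact ((\<lambda>(t, x). f t x) ` ({0..T} \<times> cbox 0 (\<chi> j. 1)))"
    by (intro compact_continuous_image compact_Times continuous_on_subset[OF cont]) auto
  then obtain B where B: "\<And>t x. t \<in> {0..T} \<Longrightarrow> x \<in> cbox 0 (\<chi> j. 1) \<Longrightarrow> \<bar>f t x\<bar> \<le> B"
    by (force dest!: compact_imp_bounded simp: bounded_iff)
  show thesis
  proof
    show "0 \<le> max B 0" by simp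
    fix t and x :: "real ^ 'd" assume t: "0 \<le> t" "t \<le> T"
    obtain m where "x - (\<chi> j. of_int (m j)) \<in> cbox 0 (\<chi> j. 1)"
      by (rule unit_cube_representative[of x])
    with B[of t] t periodic_representative[OF per[OF t(1)], of x m]
    show "\<bar>f t x\<bar> \<le> max B 0" by (metis atLeastAtMost_iff max.coboundedI1)
  qed
qed

text \<open>The weight \<open>exp (- (K + 1) t)\<close> turns the linear term into a strict sign: at a negative minimum of
  the weighted function the time derivative of \<open>v\<close> is at most \<open>(K + 1) v\<close> and the Laplacian is
  nonnegative, which contradicts the differential inequality.\<close>

lemma weak_minimum_principle:
  fixes v :: "real \<Rightarrow> real ^ 'd \<Rightarrow> real"
  assumes per: "\<And>t. 0 \<le> t \<Longrightarrow> torus_periodic (v t)"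
    and cont: "continuous_on ({0..} \<times> UNIV) (\<lambda>(t, x). v t x)"
    and time: "\<And>t x. 0 < t \<Longrightarrow> (\<lambda>s. v s x) differentiable (at t)"
    and space: "\<And>t x. 0 < t \<Longrightarrow> v t differentiable (at x)"
      "\<And>t x. 0 < t \<Longrightarrow> grad (v t) differentiable (at x)"
    and init: "\<And>x. 0 \<le> v 0 x"
    and super: "\<And>t x. 0 < t \<Longrightarrow> t \<le> T \<Longrightarrow> v t x < 0 \<Longrightarrow>
      laplacian (v t) x + K * v t x \<le> deriv (\<lambda>s. v s x) t"
    and t: "0 \<le> t" "t \<le> T"
  shows "0 \<le> v t x"
proof (rule ccontr)
  assume neg: "\<not> 0 \<le> v t x"
  define z where "z = (\<lambda>(s, y). exp (- (K + 1) * s) * v s y)"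
  let ?Q = "{0..T} \<times> cbox 0 (\<chi> j. 1) :: (real \<times> (real ^ 'd)) set"
  have "continuous_on ?Q (\<lambda>(s, y). v s y)" by (rule continuous_on_subset[OF cont]) auto
  then have zc: "continuous_on ?Q z"
    unfolding z_def case_prod_unfold by (intro continuous_intros)
  have rep: "\<exists>y'. (s, y') \<in> ?Q \<and> v s y' = v s y" if "0 \<le> s" "s \<le> T" for s y
  proof -
    obtain m where "y - (\<chi> j. of_int (m j)) \<in> cbox 0 (\<chi> j. 1)"
      by (rule unit_cube_representative[of y])
    with that periodic_representative[OF per[OF that(1)], of y m] show ?thesis by auto
  qed
  have "?Q \<noteq> {}" using rep[OF t, of x] by blast
  moreover have "compact ?Q" by (intro compact_Times) auto
  ultimately obtain q where q: "q \<in> ?Q" "\<And>r. r \<in> ?Q \<Longrightarrow> z q \<le> z r"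
    using continuous_attains_inf[OF _ _ zc] by blast
  obtain s y where sy: "q = (s, y)" by (cases q)
  have s: "0 \<le> s" "s \<le> T" using q(1) sy by auto
  have min: "exp (- (K + 1) * s) * v s y \<le> exp (- (K + 1) * s') * v s' y'"
    if "0 \<le> s'" "s' \<le> T" for s' y'
    using rep[OF that, of y'] q(2) unfolding sy z_def by fastforce
  have "exp (- (K + 1) * s) * v s y < 0"
    using min[OF t, of x] neg by (smt (verit) exp_gt_zero mult_pos_neg)
  then have vneg: "v s y < 0" by (simp add: mult_less_0_iff)
  then have "0 < s" using init[of y] s(1) by (cases "s = 0") auto
  have "v s y \<le> v s y'" for y' using min[OF s, of y'] by simp
  then have lap: "0 \<le> laplacian (v s) y"
    by (intro laplacian_nonneg_at_minimum space \<open>0 < s\<close>)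
  have D: "((\<lambda>s. v s y) has_real_derivative deriv (\<lambda>s. v s y) s) (at s)"
    using time[OF \<open>0 < s\<close>] by (simp add: DERIV_deriv_iff_real_differentiable)
  have "((\<lambda>s. - (exp (- (K + 1) * s) * v s y)) has_real_derivative
      - (exp (- (K + 1) * s) * (deriv (\<lambda>s. v s y) s - (K + 1) * v s y))) (at s)"
    by (auto intro!: derivative_eq_intros D simp: algebra_simps)
  from derivative_nonneg_at_last_maximum[OF this \<open>0 < s\<close>]
  have "0 \<le> - (exp (- (K + 1) * s) * (deriv (\<lambda>s. v s y) s - (K + 1) * v s y))"
    using min s by simp
  then have "deriv (\<lambda>s. v s y) s - (K + 1) * v s y \<le> 0"
    by (simp add: mult_le_0_iff)
  moreover have "K * v s y \<le> deriv (\<lambda>s. v s y) s"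
    using super[OF \<open>0 < s\<close> s(2) vneg] lap by simp
  ultimately show False using vneg by (simp add: algebra_simps)
qed

section \<open>Solutions stay between the wells\<close>

lemma allen_cahn_solutionD:
  assumes "allen_cahn_solution \<alpha> \<epsilon> u0 u" "0 < \<epsilon>"
  shows "0 \<le> t \<Longrightarrow> torus_periodic (\<lambda>x. u t x $ i)"
    and "continuous_on ({0..} \<times> UNIV) (\<lambda>(t, x). u t x $ i)"
    and "0 < t \<Longrightarrow> (\<lambda>s. u s x $ i) differentiable (at t)"
    and "0 < t \<Longrightarrow> (\<lambda>x. u t x $ i) differentiable (at x)"
    and "0 < t \<Longrightarrow> grad (\<lambda>x. u t x $ i) differentiable (at x)"
    and "u 0 = u0"
    and "0 < t \<Longrightarrow> deriv (\<lambda>s. u s x $ i) t = laplacian (\<lambda>y. u t y $ i) x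
      - 2 * (u t x $ i * (1 - u t x $ i)) * (1 - 2 * u t x $ i) / \<epsilon>\<^sup>2
      + sqrt (2 * W (u t x $ i)) * volume_defect (u t x) / (\<epsilon> * \<epsilon> powr \<alpha>)"
proof -
  note sol = assms(1)[unfolded allen_cahn_solution_def C21_def]
  show "torus_periodic (\<lambda>x. u t x $ i)" if "0 \<le> t"
    using sol that by (simp add: torus_periodic_def)
  have "continuous_on ({0..} \<times> UNIV) (\<lambda>z. (\<lambda>(t, x). u t x) z $ i)"
    using sol by (intro bounded_linear.continuous_on[OF bounded_linear_vec_nth]) blast
  then show "continuous_on ({0..} \<times> UNIV) (\<lambda>(t, x). u t x $ i)"
    by (simp add: case_prod_unfold)
  show "(\<lambda>s. u s x $ i) differentiable (at t)" "(\<lambda>x. u t x $ i) differentiable (at x)"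
    "grad (\<lambda>x. u t x $ i) differentiable (at x)" if "0 < t"
    using sol that by blast+
  show "u 0 = u0" using sol by (intro ext) blast
  assume "0 < t"
  with sol have "\<epsilon> * deriv (\<lambda>s. u s x $ i) t =
          \<epsilon> * laplacian (\<lambda>y. u t y $ i) x - 1 / \<epsilon> * deriv W (u t x $ i)
          + 1 / \<epsilon> powr \<alpha> * sqrt (2 * W (u t x $ i)) * volume_defect (u t x)"
    unfolding volume_defect_def by blast
  then show "deriv (\<lambda>s. u s x $ i) t = laplacian (\<lambda>y. u t y $ i) x
      - 2 * (u t x $ i * (1 - u t x $ i)) * (1 - 2 * u t x $ i) / \<epsilon>\<^sup>2
      + sqrt (2 * W (u t x $ i)) * volume_defect (u t x) / (\<epsilon> * \<epsilon> powr \<alpha>)"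
    unfolding DERIV_imp_deriv[OF DERIV_W] using \<open>0 < \<epsilon>\<close>
    by (simp add: field_simps power2_eq_square)
qed

lemma volume_defect_bounded:
  fixes u :: "real \<Rightarrow> real ^ 'd \<Rightarrow> real ^ 'n"
  assumes "allen_cahn_solution \<alpha> \<epsilon> u0 u" "0 < \<epsilon>"
  obtains B where "0 \<le> B" "\<And>t x. 0 \<le> t \<Longrightarrow> t \<le> T \<Longrightarrow> \<bar>volume_defect (u t x)\<bar> \<le> B"
proof (rule bounded_if_periodic[of "\<lambda>t x. volume_defect (u t x)" T])
  show "torus_periodic (\<lambda>x. volume_defect (u t x))" if "0 \<le> t" for t
    using assms(1) that by (simp add: allen_cahn_solution_def torus_periodic_def)
  have "continuous_on ({0..} \<times> UNIV) (\<lambda>z. phi (u (fst z) (snd z) $ j))" for j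
    using continuous_on_compose2[OF continuous_phi allen_cahn_solutionD(2)[OF assms, of j]]
    by (simp add: case_prod_unfold)
  then show "continuous_on ({0..} \<times> UNIV) (\<lambda>(t, x). volume_defect (u t x))"
    unfolding volume_defect_def case_prod_unfold by (intro continuous_intros)
qed (use that in blast)

text \<open>Outside \<open>[0,1]\<close> the force of \<open>W\<close> points back towards the interval, and on bounded time
  intervals the coupling term is at most a constant times the distance to \<open>0\<close> or \<open>1\<close>, because
  \<open>sqrt (2 W)\<close> vanishes there to first order. So the minimum principle applies to \<open>u\<^sub>i\<close> and to \<open>1 - u\<^sub>i\<close>.\<close>

lemma allen_cahn_range:
  fixes u :: "real \<Rightarrow> real ^ 'd \<Rightarrow> real ^ 'n"
  assumes sol: "allen_cahn_solution \<alpha> \<epsilon> u0 u" "0 < \<epsilon>"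
    and init: "\<And>x i. u0 x $ i \<in> {0..1}"
    and "0 \<le> t"
  shows "u t x $ i \<in> {0..1}"
proof -
  note ac = allen_cahn_solutionD[OF sol]
  obtain B where B: "0 \<le> B" "\<And>s y. 0 \<le> s \<Longrightarrow> s \<le> t \<Longrightarrow> \<bar>volume_defect (u s y)\<bar> \<le> B"
    by (rule volume_defect_bounded[OF sol, where T = t]) blast
  obtain N where N: "0 \<le> N" "\<And>s y. 0 \<le> s \<Longrightarrow> s \<le> t \<Longrightarrow> \<bar>u s y $ i\<bar> \<le> N"
    by (rule bounded_if_periodic[of "\<lambda>s y. u s y $ i" t, OF ac(1) ac(2)]) blast+
  define c where "c = 1 / (\<epsilon> * \<epsilon> powr \<alpha>)"
  have c: "0 \<le> c" using \<open>0 < \<epsilon>\<close> by (simp add: c_def)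
  define K where "K = c * (sqrt 2 * (1 + N) * B)"
  have force: "\<bar>sqrt (2 * W a) * volume_defect (u s y) * c\<bar> \<le> K * m"
    if "0 \<le> s" "s \<le> t" "\<bar>a * (1 - a)\<bar> \<le> m * (1 + N)" "0 \<le> m" for s y a m
  proof -
    have "\<bar>sqrt (2 * W a) * volume_defect (u s y)\<bar>
        = sqrt 2 * \<bar>a * (1 - a)\<bar> * \<bar>volume_defect (u s y)\<bar>"
      by (simp add: sqrt_2W abs_mult)
    also have "\<dots> \<le> (sqrt 2 * (m * (1 + N))) * B"
      by (rule mult_mono[OF mult_left_mono[OF that(3)] B(2)]) (use that N in auto)
    finally have "\<bar>sqrt (2 * W a) * volume_defect (u s y)\<bar> \<le> (sqrt 2 * (m * (1 + N))) * B" .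
    then have "\<bar>sqrt (2 * W a) * volume_defect (u s y)\<bar> * c \<le> (sqrt 2 * (m * (1 + N))) * B * c"
      using c by (intro mult_right_mono)
    then show ?thesis using c by (simp add: abs_mult K_def mult_ac)
  qed
  have eq: "deriv (\<lambda>s. u s y $ i) s = laplacian (\<lambda>y. u s y $ i) y
      - 2 * (u s y $ i * (1 - u s y $ i)) * (1 - 2 * u s y $ i) / \<epsilon>\<^sup>2
      + sqrt (2 * W (u s y $ i)) * volume_defect (u s y) * c" if "0 < s" for s y
    using ac(7)[OF that] by (simp add: c_def)
  have "0 \<le> u t x $ i"
  proof (rule weak_minimum_principle[where v = "\<lambda>t x. u t x $ i" and T = t and K = K])
    fix s y assume s: "0 < s" "s \<le> t" and neg: "u s y $ i < 0"
    let ?a = "u s y $ i"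
    have "\<bar>?a * (1 - ?a)\<bar> \<le> - ?a * (1 + N)"
      unfolding abs_mult using N(2)[of s y] s neg by (intro mult_mono) auto
    then have "\<bar>sqrt (2 * W ?a) * volume_defect (u s y) * c\<bar> \<le> K * - ?a"
      using s neg by (intro force) auto
    moreover have "(?a * (1 - ?a)) * (1 - 2 * ?a) \<le> 0"
      using neg by (intro mult_nonpos_nonneg) auto
    then have "2 * (?a * (1 - ?a)) * (1 - 2 * ?a) / \<epsilon>\<^sup>2 \<le> 0"
      by (intro divide_nonpos_nonneg) auto
    ultimately show "laplacian (\<lambda>y. u s y $ i) y + K * ?a \<le> deriv (\<lambda>s. u s y $ i) s"
      unfolding eq[OF s(1)] by (simp add: abs_le_iff)
  qed (use ac init \<open>0 \<le> t\<close> in auto)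
  moreover have "0 \<le> 1 - u t x $ i"
  proof (rule weak_minimum_principle[where v = "\<lambda>t x. 1 - u t x $ i" and T = t and K = K])
    have D1: "((\<lambda>s. 1 - s) has_real_derivative -1) (at r)" for r :: real
      by (auto intro!: derivative_eq_intros)
    note lc = laplacian_compose[where P = "\<lambda>s. 1 - s" and P' = "\<lambda>_. -1" and p = 0, OF D1 DERIV_const
      ac(4) ac(5)]
    show "grad (\<lambda>x. 1 - u t x $ i) differentiable (at x)" if "0 < t" for t x
      using lc(1) that by blast
    show "continuous_on ({0..} \<times> UNIV) (\<lambda>(t, x). 1 - u t x $ i)"
      using continuous_on_diff[OF continuous_on_const ac(2)[of i], of 1]
      by (simp add: case_prod_unfold)
    fix s y assume s: "0 < s" "s \<le> t" and neg: "1 - u s y $ i < 0"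
    let ?a = "u s y $ i"
    have lap: "laplacian (\<lambda>y. 1 - u s y $ i) y = - laplacian (\<lambda>y. u s y $ i) y"
      using lc(2)[of s] s(1) by simp
    have "((\<lambda>s. u s y $ i) has_real_derivative deriv (\<lambda>s. u s y $ i) s) (at s)"
      using ac(3)[OF s(1)] by (simp add: DERIV_deriv_iff_real_differentiable)
    from DERIV_imp_deriv[OF DERIV_diff[OF DERIV_const this, of 1]]
    have dt: "deriv (\<lambda>s. 1 - u s y $ i) s = - deriv (\<lambda>s. u s y $ i) s" by simp
    have "\<bar>?a * (1 - ?a)\<bar> \<le> (1 + N) * (?a - 1)"
      unfolding abs_mult using N(2)[of s y] s neg by (intro mult_mono) auto
    then have "\<bar>?a * (1 - ?a)\<bar> \<le> (?a - 1) * (1 + N)" by (simp add: mult.commute)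
    then have "\<bar>sqrt (2 * W ?a) * volume_defect (u s y) * c\<bar> \<le> K * (?a - 1)"
      using s neg by (intro force) auto
    moreover have "K * (?a - 1) = - (K * (1 - ?a))" by (simp add: algebra_simps)
    moreover have "0 \<le> (?a * (1 - ?a)) * (1 - 2 * ?a)"
      using neg by (intro mult_nonpos_nonpos mult_nonneg_nonpos) auto
    then have "0 \<le> 2 * (?a * (1 - ?a)) * (1 - 2 * ?a) / \<epsilon>\<^sup>2"
      by (intro divide_nonneg_nonneg) auto
    ultimately show "laplacian (\<lambda>y. 1 - u s y $ i) y + K * (1 - ?a) \<le> deriv (\<lambda>s. 1 - u s y $ i) s"
      unfolding dt lap eq[OF s(1)] by (simp add: abs_le_iff)
  qed (use ac init \<open>0 \<le> t\<close> in \<open>auto intro!: derivative_intros simp: torus_periodic_def\<close>)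
  ultimately show ?thesis by simp
qed

section \<open>The two-point estimate\<close>

text \<open>If \<open>v = q (p)\<close> with a profile \<open>q\<close>, the chain rule produces the term \<open>(q''/q') |grad p|\<^sup>2\<close>. At a point
  with \<open>|grad p| = 1/\<epsilon>\<close> the part of it that comes from \<open>W'\<close> cancels the force of the potential, and only
  the drift of the barrier and the coupling term are left.\<close>

lemma straightened_equation:
  fixes u :: "real \<Rightarrow> real ^ 'd \<Rightarrow> real ^ 'n"
    and i :: "'n"
  assumes sol: "allen_cahn_solution \<alpha> \<epsilon> u0 u" "0 < \<epsilon>"
    and \<eta>: "0 < \<eta>" "\<eta> \<le> 1" and t: "0 < t"
  defines "p \<equiv> \<lambda>t x. straighten \<eta> (u t x $ i)"
  shows "p t differentiable (at x)" "grad (p t) differentiable (at x)"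
    "grad (p t) x = (1 / slope \<eta> (u t x $ i)) *\<^sub>R grad (\<lambda>x. u t x $ i) x"
    "((\<lambda>s. p s x) has_real_derivative deriv (\<lambda>s. u s x $ i) t / slope \<eta> (u t x $ i)) (at t)"
    "norm (grad (p t) x) = 1 / \<epsilon> \<Longrightarrow>
      \<epsilon>\<^sup>2 * (deriv (\<lambda>s. u s x $ i) t / slope \<eta> (u t x $ i)) = \<epsilon>\<^sup>2 * laplacian (p t) x
        + (\<eta> * (1 - 2 * u t x $ i) / slope \<eta> (u t x $ i)
        + \<epsilon> powr (1 - \<alpha>) * (sqrt (2 * W (u t x $ i)) / slope \<eta> (u t x $ i)) * volume_defect (u t x))"
proof -
  note ac = allen_cahn_solutionD[OF sol]
  let ?a = "u t x $ i"
  let ?v = "\<lambda>x. u t x $ i"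
  let ?S = "slope \<eta> ?a"
  let ?S' = "(1 - 2 * ?a) * (2 * (?a * (1 - ?a)) + \<eta>) / ?S"
  have S: "?S > 0" using slope_pos[OF \<eta>] .
  note P = DERIV_straighten[OF \<eta>]
  have P': "((\<lambda>v. 1 / slope \<eta> v) has_real_derivative - ?S' / ?S\<^sup>2) (at ?a)"
    using S DERIV_slope[OF \<eta>, of ?a]
    by (auto intro!: derivative_eq_intros simp: power2_eq_square)
  have pt: "p t = (\<lambda>x. straighten \<eta> (?v x))" by (simp add: p_def)
  show "p t differentiable (at x)"
    unfolding pt using grad_compose(1)[OF P ac(4)[OF t]] by (rule differentiableI)
  show grad: "grad (p t) x = (1 / ?S) *\<^sub>R grad ?v x"
    unfolding pt by (rule grad_compose(2)[OF P ac(4)[OF t]])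
  note lc = laplacian_compose[OF P P' ac(4)[OF t] ac(5)[OF t]]
  show "grad (p t) differentiable (at x)" unfolding pt by (rule lc(1))
  have "((\<lambda>s. u s x $ i) has_real_derivative deriv (\<lambda>s. u s x $ i) t) (at t)"
    using ac(3)[OF t] by (simp add: DERIV_deriv_iff_real_differentiable)
  from DERIV_chain2[OF P this]
  show "((\<lambda>s. p s x) has_real_derivative deriv (\<lambda>s. u s x $ i) t / ?S) (at t)"
    by (simp add: p_def)
  assume "norm (grad (p t) x) = 1 / \<epsilon>"
  then have "norm (grad ?v x) = ?S / \<epsilon>"
    unfolding grad using S by (simp add: field_simps)
  then have lap: "laplacian (p t) x = laplacian ?v x / ?S - ?S' / \<epsilon>\<^sup>2"
    unfolding pt lc(2) using S by (simp add: power_divide)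
  have drift: "?S' - 2 * (?a * (1 - ?a)) * (1 - 2 * ?a) / ?S = \<eta> * (1 - 2 * ?a) / ?S"
    by (simp add: diff_divide_distrib[symmetric] algebra_simps)
  have "\<epsilon> powr (1 - \<alpha>) = \<epsilon>\<^sup>2 / (\<epsilon> * \<epsilon> powr \<alpha>)"
    using \<open>0 < \<epsilon>\<close> by (simp add: powr_diff power2_eq_square)
  then have pow: "\<epsilon>\<^sup>2 * (z / (\<epsilon> * \<epsilon> powr \<alpha>)) = \<epsilon> powr (1 - \<alpha>) * z" for z by simp
  have e2: "\<epsilon>\<^sup>2 * (z / \<epsilon>\<^sup>2) = z" for z using \<open>0 < \<epsilon>\<close> by simp
  have "\<epsilon>\<^sup>2 * (deriv (\<lambda>s. u s x $ i) t / ?S) = (\<epsilon>\<^sup>2 * laplacian ?v x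
      - \<epsilon>\<^sup>2 * (2 * (?a * (1 - ?a)) * (1 - 2 * ?a) / \<epsilon>\<^sup>2)
      + \<epsilon>\<^sup>2 * (sqrt (2 * W ?a) * volume_defect (u t x) / (\<epsilon> * \<epsilon> powr \<alpha>))) / ?S"
    unfolding ac(7)[OF t] by (simp add: algebra_simps)
  also have "\<dots> = \<epsilon>\<^sup>2 * (laplacian ?v x / ?S) - 2 * (?a * (1 - ?a)) * (1 - 2 * ?a) / ?S
      + \<epsilon> powr (1 - \<alpha>) * (sqrt (2 * W ?a) / ?S) * volume_defect (u t x)"
    unfolding e2 pow by (simp add: add_divide_distrib diff_divide_distrib)
  also have "\<epsilon>\<^sup>2 * (laplacian ?v x / ?S) = \<epsilon>\<^sup>2 * laplacian (p t) x + ?S'"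
    unfolding lap right_diff_distrib e2 by simp
  finally show "\<epsilon>\<^sup>2 * (deriv (\<lambda>s. u s x $ i) t / ?S) = \<epsilon>\<^sup>2 * laplacian (p t) x
        + (\<eta> * (1 - 2 * ?a) / ?S
        + \<epsilon> powr (1 - \<alpha>) * (sqrt (2 * W ?a) / ?S) * volume_defect (u t x))"
    using drift by linarith
qed

text \<open>Subtracting \<open>L norm (x - y)\<close> breaks periodicity in \<open>x\<close> and \<open>y\<close> separately but not under a common
  translation. So \<open>y\<close> may be taken in the unit cube, and positivity then confines \<open>x\<close> to a ball, since
  \<open>p\<close> is bounded. The maximum is taken over the components as well.\<close>

lemma two_point_maximum_attained:
  fixes p :: "'n::finite \<Rightarrow> real \<Rightarrow> real ^ 'd \<Rightarrow> real"
  assumes per: "\<And>i t. 0 \<le> t \<Longrightarrow> torus_periodic (p i t)"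
    and cont: "\<And>i. continuous_on ({0..} \<times> UNIV) (\<lambda>(t, x). p i t x)"
    and "0 < L"
    and pos: "0 \<le> t" "t \<le> T" "0 < p i t x - p i t y - L * norm (x - y)"
  obtains i' t' x' y' where "0 \<le> t'" "t' \<le> T" "0 < p i' t' x' - p i' t' y' - L * norm (x' - y')"
    "\<And>j s z w. 0 \<le> s \<Longrightarrow> s \<le> T \<Longrightarrow>
      p j s z - p j s w - L * norm (z - w) \<le> p i' t' x' - p i' t' y' - L * norm (x' - y')"
proof -
  define Z where "Z j = (\<lambda>(s, z, w). p j s z - p j s w - L * norm (z - w))" for j
  have "\<exists>B. \<forall>s z. 0 \<le> s \<longrightarrow> s \<le> T \<longrightarrow> \<bar>p j s z\<bar> \<le> B" for j
    by (rule bounded_if_periodic[of "p j" T, OF per cont]) blast+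
  then obtain B where B: "\<And>j s z. 0 \<le> s \<Longrightarrow> s \<le> T \<Longrightarrow> \<bar>p j s z\<bar> \<le> B j" by metis
  define b where "b = Max (range B)"
  have "B j \<le> b" for j by (simp add: b_def)
  then have b: "\<bar>p j s z\<bar> \<le> b" if "0 \<le> s" "s \<le> T" for j s z using B[OF that] order_trans by blast
  let ?C = "cbox 0 (\<chi> j. 1) :: (real ^ 'd) set"
  obtain d where d: "\<And>z. z \<in> ?C \<Longrightarrow> norm z \<le> d" using bounded_cbox bounded_iff by metis
  define Q where "Q = {0..T} \<times> (cball 0 (2 * b / L + d) :: (real ^ 'd) set) \<times> ?C"
  have cQ: "compact Q" unfolding Q_def by (intro compact_Times) auto
  have Zc: "continuous_on Q (Z j)" for j
  proof -
    have "continuous_on Q (\<lambda>q. (\<lambda>(t, x). p j t x) (fst q, fst (snd q)))"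
      "continuous_on Q (\<lambda>q. (\<lambda>(t, x). p j t x) (fst q, snd (snd q)))"
      by (rule continuous_on_compose2[OF cont]; auto intro!: continuous_intros simp: Q_def)+
    then show ?thesis
      unfolding Z_def case_prod_unfold by (auto intro!: continuous_intros)
  qed
  have rep: "\<exists>q\<in>Q. Z j q = Z j (s, z, w)" if "0 \<le> s" "s \<le> T" "0 < Z j (s, z, w)" for j s z w
  proof -
    obtain m where m: "w - (\<chi> j. of_int (m j)) \<in> ?C" by (rule unit_cube_representative[of w])
    let ?k = "(\<chi> j. of_int (m j)) :: real ^ 'd"
    have "L * norm (z - w) \<le> 2 * b"
      using that(3) b[OF that(1,2), of j z] b[OF that(1,2), of j w]
      unfolding Z_def by (simp add: abs_le_iff)
    then have "norm (z - w) \<le> 2 * b / L" using \<open>0 < L\<close> by (simp add: pos_le_divide_eq mult.commute)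
    moreover have "norm (z - ?k) \<le> norm (z - w) + norm (w - ?k)"
      using norm_triangle_ineq[of "z - w" "w - ?k"] by simp
    ultimately have "norm (z - ?k) \<le> 2 * b / L + d" using d[OF m] by linarith
    then have "(s, z - ?k, w - ?k) \<in> Q" using that m by (simp add: Q_def)
    moreover have "Z j (s, z - ?k, w - ?k) = Z j (s, z, w)"
      using periodic_representative[OF per[OF that(1)]] by (simp add: Z_def)
    ultimately show ?thesis by blast
  qed
  have "Z i (t, x, y) > 0" using pos(3) by (simp add: Z_def)
  from rep[OF pos(1,2) this] obtain q0 where q0: "q0 \<in> Q" "Z i q0 = Z i (t, x, y)" by blast
  have "\<exists>q\<in>Q. \<forall>r\<in>Q. Z j r \<le> Z j q" for j
    using continuous_attains_sup[OF cQ _ Zc] q0(1) by blast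
  then obtain q where q: "\<And>j. q j \<in> Q" "\<And>j r. r \<in> Q \<Longrightarrow> Z j r \<le> Z j (q j)" by metis
  define M where "M = Max (range (\<lambda>j. Z j (q j)))"
  have "M \<in> range (\<lambda>j. Z j (q j))" unfolding M_def by (rule Max_in) auto
  then obtain i' where i': "M = Z i' (q i')" by blast
  have M: "Z j (q j) \<le> M" for j by (simp add: M_def)
  have pM: "0 < M" using M[of i] q(2)[OF q0(1), of i] q0(2) \<open>Z i (t, x, y) > 0\<close> by linarith
  have max: "Z j (s, z, w) \<le> M" if "0 \<le> s" "s \<le> T" for j s z w
  proof (cases "0 < Z j (s, z, w)")
    case True
    from rep[OF that True] obtain r where "r \<in> Q" "Z j r = Z j (s, z, w)" by blast
    then show ?thesis using q(2)[of r j] M[of j] by linarith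
  qed (use pM in linarith)
  obtain t' x' y' where e: "q i' = (t', x', y')" by (cases "q i'") auto
  show thesis
  proof (rule that[of t' i' x' y'])
    show "0 \<le> t'" "t' \<le> T" using q(1)[of i'] e by (auto simp: Q_def)
    show "0 < p i' t' x' - p i' t' y' - L * norm (x' - y')"
      using pM unfolding i' e by (simp add: Z_def)
    show "p j s z - p j s w - L * norm (z - w) \<le> p i' t' x' - p i' t' y' - L * norm (x' - y')"
      if "0 \<le> s" "s \<le> T" for j s z w
      using max[OF that, of j z w] unfolding i' e by (simp add: Z_def)
  qed
qed

text \<open>The two-point maximum principle. At a positive maximum over all times, components and pairs of
  points, the gradients at both points have norm exactly \<open>1/\<epsilon>\<close>, parallel translation of the pair
  compares the Laplacians, and the time derivative of the difference is nonnegative. The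
  straightened equation then forces the reaction at \<open>x\<close> to be at least the one at \<open>y\<close>, but it is
  strictly smaller.\<close>

lemma straightened_solution_lipschitz:
  fixes u :: "real \<Rightarrow> real ^ 'd \<Rightarrow> real ^ 'n"
  assumes sol: "allen_cahn_solution \<alpha> \<epsilon> u0 u" "0 < \<epsilon>"
    and \<eta>: "0 < \<eta>" "\<eta> \<le> 1" and small: "2 * real CARD('n) * \<epsilon> powr (1 - \<alpha>) \<le> \<eta>"
    and range0: "\<And>x i. u0 x $ i \<in> {0..1}"
    and init: "\<And>i x y. straighten \<eta> (u0 x $ i) - straighten \<eta> (u0 y $ i) \<le> 1 / \<epsilon> * norm (x - y)"
    and "0 \<le> t"
  shows "straighten \<eta> (u t x $ i) - straighten \<eta> (u t y $ i) \<le> 1 / \<epsilon> * norm (x - y)"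
proof (rule ccontr)
  define p where "p i t x = straighten \<eta> (u t x $ i)" for i t x
  note ac = allen_cahn_solutionD[OF sol]
  have range: "u s z $ j \<in> {0..1}" if "0 \<le> s" for s z j
    by (rule allen_cahn_range[OF sol range0 that])
  assume "\<not> ?thesis"
  then have *: "0 < p i t x - p i t y - 1 / \<epsilon> * norm (x - y)" by (simp add: p_def)
  have Pc: "continuous_on UNIV (straighten \<eta>)"
    using DERIV_straighten[OF \<eta>] by (intro DERIV_continuous_on) (auto intro: has_field_derivative_at_within)
  have per: "torus_periodic (p i t)" if "0 \<le> t" for i t
    using ac(1)[OF that] by (simp add: torus_periodic_def p_def)
  have cont: "continuous_on ({0..} \<times> UNIV) (\<lambda>(t, x). p i t x)" for i
    using continuous_on_compose2[OF Pc ac(2)[of i]] by (simp add: p_def case_prod_unfold)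
  obtain k s x y where s: "0 \<le> s" "s \<le> t"
    and pos: "0 < p k s x - p k s y - 1 / \<epsilon> * norm (x - y)"
    and max: "\<And>j r z w. 0 \<le> r \<Longrightarrow> r \<le> t \<Longrightarrow>
      p j r z - p j r w - 1 / \<epsilon> * norm (z - w) \<le> p k s x - p k s y - 1 / \<epsilon> * norm (x - y)"
    using two_point_maximum_attained[where p = p and L = "1 / \<epsilon>" and T = t, OF per cont _ \<open>0 \<le> t\<close> order_refl *]
      \<open>0 < \<epsilon>\<close> by (metis zero_less_divide_1_iff)
  have "x \<noteq> y" using pos by auto
  have "s \<noteq> 0" using init[of x k y] pos ac(6) by (auto simp: p_def)
  then have "0 < s" using s by simp
  let ?a = "u s x" and ?b = "u s y"
  note eq = straightened_equation[OF sol \<eta> \<open>0 < s\<close>, where i = k, folded p_def]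
  have gx: "grad (p k s) x = (1 / \<epsilon>) *\<^sub>R sgn (x - y)"
  proof (rule grad_at_separated_maximum[OF \<open>x \<noteq> y\<close> eq(1)])
    show "p k s z - 1 / \<epsilon> * norm (z - y) \<le> p k s x - 1 / \<epsilon> * norm (x - y)" for z
      using max[OF s, of k z y] by linarith
  qed
  have neg: "((\<lambda>r. - r) has_real_derivative -1) (at r)" for r :: real
    by (auto intro!: derivative_eq_intros)
  \<comment> \<open>Exchanging the roles of the two points turns the maximum in the second point into one for \<open>- p\<close>.\<close>
  have "grad (\<lambda>z. - p k s z) y = (1 / \<epsilon>) *\<^sub>R sgn (y - x)"
  proof (rule grad_at_separated_maximum[OF \<open>x \<noteq> y\<close>[symmetric]])
    show "(\<lambda>z. - p k s z) differentiable (at y)" using eq(1) by simp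
    show "- p k s z - 1 / \<epsilon> * norm (z - x) \<le> - p k s y - 1 / \<epsilon> * norm (y - x)" for z
      using max[OF s, of k x z] by (simp add: norm_minus_commute)
  qed
  moreover have "grad (\<lambda>z. - p k s z) y = - grad (p k s) y"
    using grad_compose(2)[OF neg eq(1)] by simp
  ultimately have gy: "grad (p k s) y = (1 / \<epsilon>) *\<^sub>R sgn (x - y)"
    by (metis minus_diff_eq minus_minus scaleR_minus_right sgn_minus)
  have nx: "norm (grad (p k s) x) = 1 / \<epsilon>" and ny: "norm (grad (p k s) y) = 1 / \<epsilon>"
    unfolding gx gy using \<open>x \<noteq> y\<close> \<open>0 < \<epsilon>\<close> by (simp_all add: norm_sgn)
  have lap: "laplacian (p k s) x \<le> laplacian (p k s) y"
  proof (rule laplacian_le_if_translates_le[OF eq(1) eq(2) eq(1) eq(2)])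
    show "p k s (x + h) - p k s (y + h) \<le> p k s x - p k s y" for h
      using max[OF s, of k "x + h" "y + h"] by simp
  qed
  let ?dx = "deriv (\<lambda>r. u r x $ k) s / slope \<eta> (?a $ k)"
  let ?dy = "deriv (\<lambda>r. u r y $ k) s / slope \<eta> (?b $ k)"
  have "0 \<le> ?dx - ?dy"
  proof (rule derivative_nonneg_at_last_maximum[OF DERIV_diff[OF eq(4) eq(4)] \<open>0 < s\<close>])
    show "p k r x - p k r y \<le> p k s x - p k s y" if "0 \<le> r" "r \<le> s" for r
      using max[of r k x y] that s by simp
  qed
  then have "\<epsilon>\<^sup>2 * ?dy \<le> \<epsilon>\<^sup>2 * ?dx" by (intro mult_left_mono) auto
  moreover have "\<epsilon>\<^sup>2 * laplacian (p k s) x \<le> \<epsilon>\<^sup>2 * laplacian (p k s) y"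
    using lap by (intro mult_left_mono) auto
  moreover have "\<eta> * (1 - 2 * ?a $ k) / slope \<eta> (?a $ k)
      + \<epsilon> powr (1 - \<alpha>) * (sqrt (2 * W (?a $ k)) / slope \<eta> (?a $ k)) * volume_defect ?a
    < \<eta> * (1 - 2 * ?b $ k) / slope \<eta> (?b $ k)
      + \<epsilon> powr (1 - \<alpha>) * (sqrt (2 * W (?b $ k)) / slope \<eta> (?b $ k)) * volume_defect ?b"
  proof (rule reaction_strictly_decreases[OF \<eta> _ small range[OF s(1)] range[OF s(1)]])
    show "0 < \<epsilon> powr (1 - \<alpha>)" using \<open>0 < \<epsilon>\<close> by simp
    have "0 \<le> 1 / \<epsilon> * norm (x - y)" using \<open>0 < \<epsilon>\<close> by simp
    then show "0 < straighten \<eta> (?a $ k) - straighten \<eta> (?b $ k)" using pos by (simp add: p_def)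
    show "\<bar>straighten \<eta> (?a $ j) - straighten \<eta> (?b $ j)\<bar>
        \<le> straighten \<eta> (?a $ k) - straighten \<eta> (?b $ k)" for j
      using max[OF s, of j x y] max[OF s, of j y x]
      by (simp add: p_def norm_minus_commute abs_le_iff)
  qed
  ultimately show False using eq(5)[OF nx] eq(5)[OF ny] by linarith
qed

text \<open>A gradient bound by the slope means that the straightened component is Lipschitz with constant
  \<open>1/\<epsilon>\<close>. In this form it makes sense at time \<open>0\<close> for solutions that are merely continuous there.\<close>

lemma gradient_bound_preserved:
  fixes u :: "real \<Rightarrow> real ^ 'd \<Rightarrow> real ^ 'n"
  assumes sol: "allen_cahn_solution \<alpha> \<epsilon> u0 u" "0 < \<epsilon>"
    and \<eta>: "0 < \<eta>" "\<eta> \<le> 1" and small: "2 * real CARD('n) * \<epsilon> powr (1 - \<alpha>) \<le> \<eta>"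
    and range0: "\<And>x i. u0 x $ i \<in> {0..1}"
    and diff0: "\<And>x i. (\<lambda>y. u0 y $ i) differentiable (at x)"
    and init: "\<And>x i. \<epsilon> * norm (grad (\<lambda>y. u0 y $ i) x) \<le> slope \<eta> (u0 x $ i)"
    and "0 \<le> t"
  shows "u t x $ i \<in> {0..1}" "\<epsilon> * norm (grad (\<lambda>y. u t y $ i) x) \<le> slope \<eta> (u t x $ i)"
proof -
  note ac = allen_cahn_solutionD[OF sol]
  note P = DERIV_straighten[OF \<eta>]
  have S: "0 < slope \<eta> v" for v by (rule slope_pos[OF \<eta>])
  show "u t x $ i \<in> {0..1}" by (rule allen_cahn_range[OF sol range0 \<open>0 \<le> t\<close>])
  have diff: "(\<lambda>y. u t y $ i) differentiable (at x)"
    using ac(4) ac(6) diff0 \<open>0 \<le> t\<close> by (cases "t = 0") auto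
  have "norm (grad (\<lambda>y. straighten \<eta> (u t y $ i)) x) \<le> 1 / \<epsilon>"
  proof (rule grad_bound_of_lipschitz)
    show "(\<lambda>y. straighten \<eta> (u t y $ i)) differentiable (at x)"
      by (rule differentiableI, rule grad_compose(1)[OF P diff])
    show "straighten \<eta> (u t z $ i) - straighten \<eta> (u t x $ i) \<le> 1 / \<epsilon> * norm (z - x)" for z
    proof (rule straightened_solution_lipschitz[OF sol \<eta> small range0 _ \<open>0 \<le> t\<close>])
      fix j :: 'n and z w
      show "straighten \<eta> (u0 z $ j) - straighten \<eta> (u0 w $ j) \<le> 1 / \<epsilon> * norm (z - w)"
      proof (rule lipschitz_of_grad_bound)
        fix z
        show "(\<lambda>y. straighten \<eta> (u0 y $ j)) differentiable (at z)"
          by (rule differentiableI, rule grad_compose(1)[OF P diff0])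
        show "norm (grad (\<lambda>y. straighten \<eta> (u0 y $ j)) z) \<le> 1 / \<epsilon>"
          unfolding grad_compose(2)[OF P diff0]
          using init[of j z] S[of "u0 z $ j"] \<open>0 < \<epsilon>\<close> by (simp add: field_simps)
      qed
    qed
  qed (use \<open>0 < \<epsilon>\<close> in simp)
  then show "\<epsilon> * norm (grad (\<lambda>y. u t y $ i) x) \<le> slope \<eta> (u t x $ i)"
    unfolding grad_compose(2)[OF P diff]
    using S[of "u t x $ i"] \<open>0 < \<epsilon>\<close> by (simp add: field_simps)
qed

section \<open>The discrepancy bound\<close>

lemma barrier_le:
  assumes "0 \<le> \<eta>" "v \<in> {0..1}"
  shows "\<eta> \<le> barrier \<eta> v" "barrier \<eta> v \<le> 2 * \<eta>"
proof -
  note w = bump_bounds[OF assms(2)]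
  show "\<eta> \<le> barrier \<eta> v" unfolding barrier_def using w assms by (simp add: mult_le_cancel_left1)
  have "\<eta> * (1 + v * (1 - v)) \<le> \<eta> * 2" using w assms by (intro mult_left_mono) auto
  then show "barrier \<eta> v \<le> 2 * \<eta>" by (simp add: barrier_def)
qed

theorem lemma5:
  fixes \<alpha> :: real
    and u0 :: "real \<Rightarrow> real ^ 'd \<Rightarrow> real ^ 'n"
    and u :: "real \<Rightarrow> real \<Rightarrow> real ^ 'd \<Rightarrow> real ^ 'n"
  assumes "0 < \<alpha>" and "\<alpha> < 1"
    and "well_prepared \<alpha> u0"
    and "\<And>\<epsilon>. 0 < \<epsilon> \<Longrightarrow> \<epsilon> \<le> 1 \<Longrightarrow> allen_cahn_solution \<alpha> \<epsilon> (u0 \<epsilon>) (u \<epsilon>)"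
  shows "\<exists>\<epsilon>1>0. \<exists>C>0. \<forall>\<epsilon>. 0 < \<epsilon> \<and> \<epsilon> < \<epsilon>1 \<longrightarrow>
    (\<forall>i. \<forall>t\<ge>0. \<forall>x.
       \<epsilon> / 2 * (norm (grad (\<lambda>y. u \<epsilon> t y $ i) x))\<^sup>2 - 1 / \<epsilon> * W (u \<epsilon> t x $ i)
         \<le> C * \<epsilon> powr (- ((1 + \<alpha>) / 2)))"
proof -
  note wp = assms(3)[unfolded well_prepared_def]
  obtain C0 where C0: "\<And>i \<epsilon> x. \<epsilon> \<in> {0<..1} \<Longrightarrow>
      \<epsilon> / 2 * (norm (grad (\<lambda>y. u0 \<epsilon> y $ i) x))\<^sup>2 - 1 / \<epsilon> * W (u0 \<epsilon> x $ i)
        \<le> C0 * \<epsilon> powr (- ((1 + \<alpha>) / 2))"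
    using wp by blast
  define n where "n = real CARD('n)"
  have "1 \<le> n" unfolding n_def by (simp add: Suc_leI)
  define M where "M = max C0 (2 * n)"
  have M: "1 \<le> M" "C0 \<le> M" "2 * n \<le> M" using \<open>1 \<le> n\<close> by (auto simp: M_def)
  define \<beta> where "\<beta> = (1 - \<alpha>) / 2"
  have \<beta>: "0 < \<beta>" using \<open>\<alpha> < 1\<close> by (simp add: \<beta>_def)
  \<comment> \<open>The condition \<open>\<epsilon> < \<epsilon>1\<close> says exactly that \<open>M * \<epsilon> powr \<beta> < 1\<close>.\<close>
  define \<epsilon>1 where "\<epsilon>1 = (1 / M) powr (1 / \<beta>)"
  have "0 < \<epsilon>1" using M(1) by (simp add: \<epsilon>1_def)
  have "\<epsilon>1 \<le> 1 powr (1 / \<beta>)" unfolding \<epsilon>1_def using M(1) \<beta> by (intro powr_mono2) auto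
  then have "\<epsilon>1 \<le> 1" by simp
  have bound: "\<epsilon> / 2 * (norm (grad (\<lambda>y. u \<epsilon> t y $ i) x))\<^sup>2 - 1 / \<epsilon> * W (u \<epsilon> t x $ i)
         \<le> 2 * M * \<epsilon> powr (- ((1 + \<alpha>) / 2))"
    if \<epsilon>: "0 < \<epsilon>" "\<epsilon> < \<epsilon>1" and "0 \<le> t" for \<epsilon> i t x
  proof -
    have "\<epsilon> \<le> 1" using \<epsilon> \<open>\<epsilon>1 \<le> 1\<close> by simp
    \<comment> \<open>\<open>\<eta>\<close> has the size of \<open>\<epsilon>\<close> times the claimed bound, so the initial data satisfy the gradient bound.
      It also dominates the coupling strength \<open>\<epsilon> powr (1 - \<alpha>) = (\<epsilon> powr \<beta>)\<^sup>2\<close>.\<close>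
    define \<eta> where "\<eta> = M * \<epsilon> powr \<beta>"
    have "\<epsilon> powr \<beta> \<le> \<epsilon>1 powr \<beta>" using \<epsilon> \<beta> by (intro powr_mono2) auto
    also have "\<dots> = 1 / M" using \<beta> M(1) by (simp add: \<epsilon>1_def powr_powr)
    finally have \<eta>: "0 < \<eta>" "\<eta> \<le> 1" using M(1) \<epsilon>(1) by (simp_all add: \<eta>_def pos_le_divide_eq mult.commute)
    have "\<epsilon> powr (1 - \<alpha>) \<le> \<epsilon> powr \<beta>"
      using \<epsilon>(1) \<open>\<epsilon> \<le> 1\<close> \<open>\<alpha> < 1\<close> by (intro powr_mono') (auto simp: \<beta>_def)
    then have small: "2 * real CARD('n) * \<epsilon> powr (1 - \<alpha>) \<le> \<eta>"
      unfolding \<eta>_def n_def[symmetric] using M(3) \<open>1 \<le> n\<close> by (intro mult_mono) auto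
    have pow: "\<epsilon> * \<epsilon> powr (- ((1 + \<alpha>) / 2)) = \<epsilon> powr \<beta>"
    proof -
      have "\<epsilon> * \<epsilon> powr (- ((1 + \<alpha>) / 2)) = \<epsilon> powr (1 + - ((1 + \<alpha>) / 2))"
        using \<epsilon>(1) by (simp only: powr_add) simp
      also have "1 + - ((1 + \<alpha>) / 2) = \<beta>" by (simp add: \<beta>_def field_simps)
      finally show ?thesis .
    qed
    have range0: "u0 \<epsilon> x $ i \<in> {0..1}" for x i using wp \<epsilon>(1) \<open>\<epsilon> \<le> 1\<close> by simp
    have diff0: "(\<lambda>y. u0 \<epsilon> y $ i) differentiable (at x)" for x i
    proof -
      have "u0 \<epsilon> differentiable (at x)" using wp \<epsilon>(1) \<open>\<epsilon> \<le> 1\<close> by simp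
      then show ?thesis
        unfolding differentiable_def using bounded_linear.has_derivative[OF bounded_linear_vec_nth] by blast
    qed
    have init: "\<epsilon> * norm (grad (\<lambda>y. u0 \<epsilon> y $ i) x) \<le> slope \<eta> (u0 \<epsilon> x $ i)" for x i
    proof -
      let ?N = "norm (grad (\<lambda>y. u0 \<epsilon> y $ i) x)" and ?W = "W (u0 \<epsilon> x $ i)"
      have "\<epsilon> * (\<epsilon> / 2 * ?N\<^sup>2 - 1 / \<epsilon> * ?W) \<le> \<epsilon> * (C0 * \<epsilon> powr (- ((1 + \<alpha>) / 2)))"
        using C0[of \<epsilon> i x] \<epsilon>(1) \<open>\<epsilon> \<le> 1\<close> by (intro mult_left_mono) auto
      also have "\<dots> = C0 * \<epsilon> powr \<beta>" unfolding pow[symmetric] by simp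
      also have "\<dots> \<le> \<eta>" unfolding \<eta>_def using M(2) by (intro mult_right_mono) auto
      also have "\<dots> \<le> barrier \<eta> (u0 \<epsilon> x $ i)" using barrier_le(1)[OF _ range0] \<eta>(1) by simp
      also have "\<epsilon> * (\<epsilon> / 2 * ?N\<^sup>2 - 1 / \<epsilon> * ?W) = (\<epsilon> * ?N)\<^sup>2 / 2 - ?W"
        using \<epsilon>(1) by (simp add: power2_eq_square algebra_simps)
      finally have "(\<epsilon> * ?N)\<^sup>2 \<le> 2 * (?W + barrier \<eta> (u0 \<epsilon> x $ i))" by simp
      then show ?thesis unfolding slope_def by (rule real_le_rsqrt)
    qed
    note sol = assms(4)[OF \<epsilon>(1) \<open>\<epsilon> \<le> 1\<close>]
    note keep = gradient_bound_preserved[OF sol \<epsilon>(1) \<eta> small range0 diff0 init \<open>0 \<le> t\<close>]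
    let ?N = "norm (grad (\<lambda>y. u \<epsilon> t y $ i) x)" and ?W = "W (u \<epsilon> t x $ i)"
    have "(\<epsilon> * ?N)\<^sup>2 \<le> (slope \<eta> (u \<epsilon> t x $ i))\<^sup>2"
      using keep(2) \<epsilon>(1) by (intro power_mono) auto
    also have "\<dots> \<le> 2 * (?W + 2 * \<eta>)"
      unfolding slope_square[OF \<eta>] using barrier_le(2)[OF _ keep(1)] \<eta>(1) by simp
    finally have "(\<epsilon> * ?N)\<^sup>2 / 2 - ?W \<le> 2 * \<eta>" by simp
    also have "(\<epsilon> * ?N)\<^sup>2 / 2 - ?W = \<epsilon> * (\<epsilon> / 2 * ?N\<^sup>2 - 1 / \<epsilon> * ?W)"
      using \<epsilon>(1) by (simp add: power2_eq_square algebra_simps)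
    also have "2 * \<eta> = \<epsilon> * (2 * M * \<epsilon> powr (- ((1 + \<alpha>) / 2)))"
      unfolding \<eta>_def pow[symmetric] by simp
    finally show ?thesis using \<epsilon>(1) by (simp only: mult_le_cancel_left_pos)
  qed
  have "0 < 2 * M" using M(1) by simp
  with \<open>0 < \<epsilon>1\<close> bound show ?thesis by blast
qed

end
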